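(* Let $r\in[1,\infty)$, let $\gamma(p)=\bigl(\sum_{\ell=1}^L[\gamma_\ell(p)]^r\bigr)^{1/r}$ with $\gamma_\ell(p)=[p\cdot G_\ell\,p]^{1/2}$, $G_\ell\in\mathbb{R}^{d\times d}$ symmetric positive definite, and let $u_D\in\mathbb{R}$. Let $n\ge1$ and let $(\Phi^n,W^n)\in S^h\times S^h_D$ be a solution of the smooth-potential scheme (defined in the context) for given $(\Phi^{n-1},W^{n-1})$. Then $$\mathcal{E}^h_\gamma(W^n,\Phi^n)-u_D\,\lambda\,(\widehat\varrho_m(\Phi^{n-1},\Phi^n),\Phi^n-\Phi^{n-1})^h+\tau_n\,(\pi^h[\widetilde b(\Phi^{n-1})]\,\nabla W^n,\nabla W^n)+\tau_n\,\frac{\lambda\rho}{a}\,\frac{\epsilon}{c_\Psi}\left|[\mu(\nabla\Phi^{n-1})]^{1/2}\,\frac{\Phi^n-\Phi^{n-1}}{\tau_n}\right|_h^2\le\mathcal{E}^h_\gamma(W^{n-1},\Phi^{n-1}).$$ In particular, if either (A) the splitting $\varrho=\varrho^++\varrho^-$ satisfies $u_D(\varrho^+)'(s)\le0$ and $-u_D(\varrho^-)'(s)\le0$ for all $s\le\frac2{\sqrt3}$, and $\Phi^{n-1}\le\frac2{\sqrt3}$ and $\Phi^n\le\frac2{\sqrt3}$; or (B) the splitting satisfies $u_D(\varrho^+)'(s)\le0$ and $-u_D(\varrho^-)'(s)\le0$ for all $s\ge-\frac2{\sqrt3}$, and $\Phi^{n-1}\ge-\frac2{\sqrt3}$ and $\Phi^n\ge-\frac2{\sqrt3}$;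 then $$\mathcal{F}^h_\gamma(W^n,\Phi^n)+\tau_n\,(\pi^h[\widetilde b(\Phi^{n-1})]\,\nabla W^n,\nabla W^n)+\tau_n\,\frac{\lambda\rho}{a}\,\frac{\epsilon}{c_\Psi}\left|[\mu(\nabla\Phi^{n-1})]^{1/2}\,\frac{\Phi^n-\Phi^{n-1}}{\tau_n}\right|_h^2\le\mathcal{F}^h_\gamma(W^{n-1},\Phi^{n-1}).$$
   Context: Domain and boundary. $\Omega\subset\mathbb{R}^d$, $d\in\{2,3\}$, is a polyhedral domain, $\partial\Omega=\overline{\partial_N\Omega}\cup\overline{\partial_D\Omega}$ with $\partial_N\Omega\cap\partial_D\Omega=\emptyset$, and one of: (i) $\partial\Omega=\partial_D\Omega$; (ii) $\partial\Omega=\partial_N\Omega$; (iii) $\Omega=(-H,H)^d$, $\partial_D\Omega=[-H,H]^{d-1}\times\{H\}$, $H>0$. In case (ii) one sets $u_D:=0$. Parameters (constants): $\epsilon>0$, $\vartheta\ge0$, $\lambda>0$, $\rho\ge0$, $\alpha>0$, $a>0$, $\mathcal{K}_\pm>0$; $b(s)=\frac12(1+s)\mathcal{K}_++\frac12(1-s)\mathcal{K}_-$, and $\widetilde b(s)=b(1)$ for $s\ge1$, $\widetilde b(s)=b(s)$ for $|s|\le1$, $\widetilde b(s)=b(-1)$ for $s\le-1$. Coefficient functions. $\beta:\mathbb{R}^d\to\mathbb{R}_{\ge0}$ is positively homogeneous of degree one with $\beta(p)>0$ for $p\ne0$; $\mu(p)=\gamma(p)/\beta(p)$ for $p\neq0$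 and $\mu(0)=\bar\mu$, a constant with $\min_{p\ne0}\gamma(p)/\beta(p)\le\bar\mu\le\max_{p\neq0}\gamma(p)/\beta(p)$. The shape function $\varrho\in C^1(\mathbb{R})$ satisfies $\varrho\ge0$ on $[-1,1]$, $\int_{-1}^1\varrho=1$, and $\mathrm{P}(s):=\int_{-1}^s\varrho(y)\,dy$. A splitting $\varrho=\varrho^++\varrho^-$ with $\varrho^\pm\in C^1(\mathbb{R})$ is fixed. For a fixed $m\ge2$, $\varrho^+_m(s):=\varrho^+(m)$ for $s\ge m$, $\varrho^+(s)$ for $|s|\le m$, $\varrho^+(-m)$ for $s\le-m$, and $\widehat\varrho_m(s_0,s_1):=\varrho^-(s_0)+\varrho^+_m(s_1)$. Potential. $\Psi:\mathbb{R}\to[0,\infty)$ is a smooth symmetric double well potential with global minima at $\pm1$, $c_\Psi=\int_{-1}^1\sqrt{2\Psi(s)}\,ds$, $\phi:=\Psi'=\phi^++\phi^-$ with $\pm(\phi^\pm)'(s)\ge0$ for all $s\in\mathbb{R}$, $\Psi^\pm(s):=\int_0^s\phi^\pm(y)\,dy$, and there are constants $\psi_0,\psi_1,\delta>0$ with $\Psi^+(s)\ge\psi_1|s|^{1+\delta}-\psi_0$ for all $s\in\mathbb{R}$. Anisotropy matrices. With the convention $\gamma_\ell(0)/\gamma(0):=1$, for all $p\in\mathbb{R}^d$: $B_r(q,p):=\gamma(q)\sum_{\ell=1}^L\bigl[\frac{\gamma_\ell(p)}{\gamma(p)}\bigr]^{r-1}[\gamma_\ell(q)]^{-1}G_\ell$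 if $q\ne0$, and $B_r(0,p):=L^{1/r}\sum_{\ell=1}^L\bigl[\frac{\gamma_\ell(p)}{\gamma(p)}\bigr]^{r-1}G_\ell$. Finite elements. $\mathcal{T}^h$ is a partitioning of $\Omega$ into disjoint open simplices; $S^h\subset H^1(\Omega)$ is the space of continuous functions on $\overline\Omega$ that are affine on each simplex, with nodal interpolation $\pi^h:C(\overline\Omega)\to S^h$. $(\cdot,\cdot)$ and $|\cdot|_0$ are the $L^2(\Omega)$ inner product and norm. For piecewise continuous functions, $(\eta_1,\eta_2)^h:=\sum_{\sigma\in\mathcal{T}^h}\frac{|\sigma|}{d+1}\sum_{k=0}^d(\eta_1\eta_2)((p_{j_k})^-)$, where $p_{j_0},\dots,p_{j_d}$ are the vertices of $\sigma$ and $\eta((p_{j_k})^-)$ is the limit from within $\sigma$; $|\eta|_h:=[(\eta,\eta)^h]^{1/2}$. $K^h:=\{\chi\in S^h:|\chi|\le1\text{ in }\Omega\}$, $S^h_0:=\{\chi\in S^h:\chi=0\text{ on }\partial_D\Omega\}$, $S^h_D:=\{\chi\in S^h:\chi=u_D\text{ on }\partial_D\Omega\}$ (for $u_D\in\mathbb{R}$). $\tau_n>0$ is the $n$-th time step. Smooth-potential scheme (step $n\ge1$). Given the previous iterates ($\Phi^0\in K^h$, and $\Phi^{n-1}\in S^h$ for $n\ge2$; $W^{n-1}\in S^h_D$, which enters only multiplied by $\vartheta$ and is irrelevant if $\vartheta=0$), find $(\Phi^n,W^n)\in S^h\times S^h_D$ such that $$\vartheta\Bigl(\tfrac{W^n-W^{n-1}}{\tau_n},\chi\Bigr)^h+\lambda\Bigl(\widehat\varrho_m(\Phi^{n-1},\Phi^n)\tfrac{\Phi^n-\Phi^{n-1}}{\tau_n},\chi\Bigr)^h+(\pi^h[\widetilde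 b(\Phi^{n-1})]\nabla W^n,\nabla\chi)=0\quad\forall\chi\in S^h_0,$$ $$\epsilon\tfrac\rho\alpha\Bigl(\mu(\nabla\Phi^{n-1})\tfrac{\Phi^n-\Phi^{n-1}}{\tau_n},\chi\Bigr)^h+\epsilon\,(B_r(\nabla\Phi^{n-1},\nabla\Phi^n)\nabla\Phi^n,\nabla\chi)+\epsilon^{-1}(\phi^+(\Phi^n),\chi)^h=\Bigl(c_\Psi\tfrac a\alpha\,\widehat\varrho_m(\Phi^{n-1},\Phi^n)W^n-\epsilon^{-1}\phi^-(\Phi^{n-1}),\chi\Bigr)^h\quad\forall\chi\in S^h.$$ Discrete energies. $\mathcal{E}^h_\gamma(W,\Phi)=\frac\vartheta2|W-u_D|_h^2+\frac{\lambda\alpha}{a}\frac1{c_\Psi}\bigl[\frac12\epsilon|\gamma(\nabla\Phi)|_0^2+\epsilon^{-1}(\Psi(\Phi),1)^h\bigr]$ and $\mathcal{F}^h_\gamma(W,\Phi)=\mathcal{E}^h_\gamma(W,\Phi)-\lambda u_D(\mathrm{P}(\Phi),1)^h$.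
   Formalization: The second inequality (for F) is stated under the extra assumption that the truncation is inactive at Φ^n, i.e. ρ^+_m(Φ^n)=ρ^+(Φ^n) in Ω (automatic if |Φ^n|≤m); without it the claim fails, e.g. in case (A) when Φ^n<-m. *)

theory Defs
  imports "HOL-Analysis.Analysis"
begin

text \<open>Functions on \<open>closure \<Omega>\<close> are represented by total functions; their values outside of
  \<open>closure \<Omega>\<close> never matter.\<close>

section \<open>Domain, boundary parts and mesh\<close>

text \<open>Lipschitz regularity of the boundary is not imposed.\<close>

definition polyhedral_domain :: "(real^'d) set \<Rightarrow> bool" where
  "polyhedral_domain \<Omega> \<longleftrightarrow>
     open \<Omega> \<and> connected \<Omega> \<and> bounded \<Omega> \<and> \<Omega> \<noteq> {} \<and>
     (\<exists>F. finite F \<and> (\<forall>f\<in>F. polytope f \<and> aff_dim f = int CARD('d) - 1) \<and> frontier \<Omega> = \<Union>F)"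

text \<open>The three admissible boundary configurations. In the last one the coordinate \<open>k\<close> plays the
  role of the last coordinate \<open>x\<^sub>d\<close>, since the finite index type \<open>'d\<close> carries no order.\<close>

definition boundary_configuration ::
    "(real^'d) set \<Rightarrow> (real^'d) set \<Rightarrow> (real^'d) set \<Rightarrow> bool" where
  "boundary_configuration \<Omega> bN bD \<longleftrightarrow>
     frontier \<Omega> = closure bN \<union> closure bD \<and> bN \<inter> bD = {} \<and>
     (frontier \<Omega> = bD \<or>
      frontier \<Omega> = bN \<or>
      (\<exists>H k. H > 0 \<and> \<Omega> = {x. \<forall>i. - H < x $ i \<and> x $ i < H} \<and>
             bD = {x. (\<forall>i. - H \<le> x $ i \<and> x $ i \<le> H) \<and> x $ k = H}))"

text \<open>A partitioning of \<open>\<Omega>\<close> into disjoint open simplices. The clause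
  \<open>triangulation (closure ` T)\<close> says that the mesh is finite and has no hanging nodes; without it
  nodal interpolation of a continuous function would not produce a continuous function.\<close>

definition simplicial_partition :: "(real^'d) set \<Rightarrow> (real^'d) set set \<Rightarrow> bool" where
  "simplicial_partition \<Omega> T \<longleftrightarrow>
     (\<forall>\<sigma>\<in>T. \<sigma> \<subseteq> \<Omega> \<and> (\<exists>K. int CARD('d) simplex K \<and> \<sigma> = interior K)) \<and>
     pairwise disjnt T \<and> closure \<Omega> = \<Union>(closure ` T) \<and> triangulation (closure ` T)"

definition vertices :: "(real^'d) set \<Rightarrow> (real^'d) set" where
  "vertices \<sigma> = {p. p extreme_point_of closure \<sigma>}"

section \<open>Finite element spaces and inner products\<close>

definition fe_space :: "(real^'d) set \<Rightarrow> (real^'d) set set \<Rightarrow> (real^'d \<Rightarrow> real) set" where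
  "fe_space \<Omega> T = {\<eta>. continuous_on (closure \<Omega>) \<eta> \<and>
                      (\<forall>\<sigma>\<in>T. \<exists>g c. \<forall>x\<in>\<sigma>. \<eta> x = g \<bullet> x + c)}"

definition fe_space_bounded :: "(real^'d) set \<Rightarrow> (real^'d) set set \<Rightarrow> (real^'d \<Rightarrow> real) set" where
  "fe_space_bounded \<Omega> T = {\<eta> \<in> fe_space \<Omega> T. \<forall>x\<in>\<Omega>. \<bar>\<eta> x\<bar> \<le> 1}"

definition fe_space_Dirichlet ::
    "(real^'d) set \<Rightarrow> (real^'d) set set \<Rightarrow> (real^'d) set \<Rightarrow> real \<Rightarrow> (real^'d \<Rightarrow> real) set" where
  "fe_space_Dirichlet \<Omega> T bD u = {\<eta> \<in> fe_space \<Omega> T. \<forall>x\<in>bD. \<eta> x = u}"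

text \<open>Nodal interpolation; the choice concerns only the values outside of \<open>closure \<Omega>\<close>.\<close>

definition nodal_interpolant ::
    "(real^'d) set \<Rightarrow> (real^'d) set set \<Rightarrow> (real^'d \<Rightarrow> real) \<Rightarrow> real^'d \<Rightarrow> real" where
  "nodal_interpolant \<Omega> T f =
     (SOME \<eta>. \<eta> \<in> fe_space \<Omega> T \<and> (\<forall>\<sigma>\<in>T. \<forall>p\<in>vertices \<sigma>. \<eta> p = f p))"

text \<open>For finite element functions the gradient is meaningful in each open simplex of the mesh,
  hence almost everywhere in \<open>\<Omega>\<close>.\<close>

definition grad :: "(real^'d \<Rightarrow> real) \<Rightarrow> real^'d \<Rightarrow> real^'d" where
  "grad f x = (THE D. GDERIV f x :> D)"

definition L2_inner ::
    "(real^'d) set \<Rightarrow> (real^'d \<Rightarrow> 'b::real_inner) \<Rightarrow> (real^'d \<Rightarrow> 'b) \<Rightarrow> real" where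
  "L2_inner \<Omega> f g = (LINT x:\<Omega>|lebesgue. f x \<bullet> g x)"

definition L2_norm :: "(real^'d) set \<Rightarrow> (real^'d \<Rightarrow> 'b::real_inner) \<Rightarrow> real" where
  "L2_norm \<Omega> f = sqrt (L2_inner \<Omega> f f)"

text \<open>The mass-lumped inner product; the arguments are piecewise continuous and are evaluated at a
  vertex as limits from within the simplex.\<close>

definition lumped_inner ::
    "(real^'d) set set \<Rightarrow> (real^'d \<Rightarrow> real) \<Rightarrow> (real^'d \<Rightarrow> real) \<Rightarrow> real" where
  "lumped_inner T \<eta>\<^sub>1 \<eta>\<^sub>2 =
     (\<Sum>\<sigma>\<in>T. measure lebesgue \<sigma> / (real CARD('d) + 1) *
        (\<Sum>p\<in>vertices \<sigma>. Lim (at p within \<sigma>) (\<lambda>x. \<eta>\<^sub>1 x * \<eta>\<^sub>2 x)))"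

definition lumped_norm :: "(real^'d) set set \<Rightarrow> (real^'d \<Rightarrow> real) \<Rightarrow> real" where
  "lumped_norm T \<eta> = sqrt (lumped_inner T \<eta> \<eta>)"

section \<open>Anisotropy\<close>

definition sym_pos_def :: "real^'d^'d \<Rightarrow> bool" where
  "sym_pos_def A \<longleftrightarrow> transpose A = A \<and> (\<forall>p. p \<noteq> 0 \<longrightarrow> p \<bullet> (A *v p) > 0)"

definition ell_norm :: "real^'d^'d \<Rightarrow> real^'d \<Rightarrow> real" where
  "ell_norm A p = sqrt (p \<bullet> (A *v p))"

definition anisotropy :: "real \<Rightarrow> nat \<Rightarrow> (nat \<Rightarrow> real^'d^'d) \<Rightarrow> real^'d \<Rightarrow> real" where
  "anisotropy r L G p = (\<Sum>l=1..L. ell_norm (G l) p powr r) powr (1 / r)"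

definition anisotropy_ratio :: "real \<Rightarrow> nat \<Rightarrow> (nat \<Rightarrow> real^'d^'d) \<Rightarrow> nat \<Rightarrow> real^'d \<Rightarrow> real" where
  "anisotropy_ratio r L G l p = (if p = 0 then 1 else ell_norm (G l) p / anisotropy r L G p)"

definition anisotropy_matrix ::
    "real \<Rightarrow> nat \<Rightarrow> (nat \<Rightarrow> real^'d^'d) \<Rightarrow> real^'d \<Rightarrow> real^'d \<Rightarrow> real^'d^'d" where
  "anisotropy_matrix r L G q p =
     (if q \<noteq> 0
      then anisotropy r L G q *\<^sub>R
             (\<Sum>l=1..L. (anisotropy_ratio r L G l p powr (r - 1) * inverse (ell_norm (G l) q)) *\<^sub>R G l)
      else (real L powr (1 / r)) *\<^sub>R
             (\<Sum>l=1..L. (anisotropy_ratio r L G l p powr (r - 1)) *\<^sub>R G l))"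

text \<open>Positive homogeneity of degree one means \<open>\<beta> (t p) = t \<beta> p\<close> for \<open>t > 0\<close>.\<close>

definition kinetic_coefficient :: "(real^'d \<Rightarrow> real) \<Rightarrow> bool" where
  "kinetic_coefficient \<beta> \<longleftrightarrow>
     (\<forall>p. 0 \<le> \<beta> p) \<and> (\<forall>t p. t > 0 \<longrightarrow> \<beta> (t *\<^sub>R p) = t * \<beta> p) \<and> (\<forall>p. p \<noteq> 0 \<longrightarrow> 0 < \<beta> p)"

text \<open>The bounds are taken in \<open>ereal\<close>, so that they make sense even if \<open>\<gamma> / \<beta>\<close> has no minimum or
  maximum; they coincide with these whenever they exist.\<close>

definition mobility_constant_ok ::
    "(real^'d \<Rightarrow> real) \<Rightarrow> (real^'d \<Rightarrow> real) \<Rightarrow> real \<Rightarrow> bool" where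
  "mobility_constant_ok \<gamma> \<beta> \<mu>\<^sub>0 \<longleftrightarrow>
     (INF p\<in>-{0}. ereal (\<gamma> p / \<beta> p)) \<le> ereal \<mu>\<^sub>0 \<and> ereal \<mu>\<^sub>0 \<le> (SUP p\<in>-{0}. ereal (\<gamma> p / \<beta> p))"

definition kinetic_mobility ::
    "(real^'d \<Rightarrow> real) \<Rightarrow> (real^'d \<Rightarrow> real) \<Rightarrow> real \<Rightarrow> real^'d \<Rightarrow> real" where
  "kinetic_mobility \<gamma> \<beta> \<mu>\<^sub>0 p = (if p = 0 then \<mu>\<^sub>0 else \<gamma> p / \<beta> p)"

section \<open>Conductivity, shape function and potential\<close>

definition conductivity :: "real \<Rightarrow> real \<Rightarrow> real \<Rightarrow> real" where
  "conductivity Kp Km s = (1 + s) / 2 * Kp + (1 - s) / 2 * Km"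

definition trunc_conductivity :: "real \<Rightarrow> real \<Rightarrow> real \<Rightarrow> real" where
  "trunc_conductivity Kp Km s =
     (if s \<ge> 1 then conductivity Kp Km 1
      else if s \<le> - 1 then conductivity Kp Km (- 1)
      else conductivity Kp Km s)"

definition shape_function :: "(real \<Rightarrow> real) \<Rightarrow> bool" where
  "shape_function f \<longleftrightarrow>
     f C1_differentiable_on UNIV \<and> (\<forall>s\<in>{-1..1}. 0 \<le> f s) \<and> (LBINT y=-1..1. f y) = 1"

definition shape_splitting :: "(real \<Rightarrow> real) \<Rightarrow> (real \<Rightarrow> real) \<Rightarrow> (real \<Rightarrow> real) \<Rightarrow> bool" where
  "shape_splitting f f\<^sub>p f\<^sub>m \<longleftrightarrow>
     f\<^sub>p C1_differentiable_on UNIV \<and> f\<^sub>m C1_differentiable_on UNIV \<and> (\<forall>s. f s = f\<^sub>p s + f\<^sub>m s)"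

definition shape_primitive :: "(real \<Rightarrow> real) \<Rightarrow> real \<Rightarrow> real" where
  "shape_primitive f s = (LBINT y=-1..s. f y)"

definition trunc_at :: "real \<Rightarrow> (real \<Rightarrow> real) \<Rightarrow> real \<Rightarrow> real" where
  "trunc_at m f s = (if s \<ge> m then f m else if s \<le> - m then f (- m) else f s)"

definition shape_hat ::
    "real \<Rightarrow> (real \<Rightarrow> real) \<Rightarrow> (real \<Rightarrow> real) \<Rightarrow> real \<Rightarrow> real \<Rightarrow> real" where
  "shape_hat m f\<^sub>p f\<^sub>m s\<^sub>0 s\<^sub>1 = f\<^sub>m s\<^sub>0 + trunc_at m f\<^sub>p s\<^sub>1"

text \<open>The condition \<open>trunc_at m f\<^sub>p (\<Phi> x) = f\<^sub>p (\<Phi> x)\<close> says that the truncation is inactive at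
  \<open>\<Phi> x\<close>. It is needed for the energy estimate that involves the primitive of the untruncated
  \<open>f = f\<^sub>p + f\<^sub>m\<close>: a one-sided bound on \<open>\<Phi>\<close> does not imply it, and without it the values of \<open>f\<^sub>p\<close>
  outside of \<open>[-m, m]\<close> enter the energy but not the scheme. It holds if \<open>\<bar>\<Phi>\<bar> \<le> m\<close>.\<close>

definition smooth :: "(real \<Rightarrow> real) \<Rightarrow> bool" where
  "smooth f \<longleftrightarrow> (\<forall>k x. ((deriv ^^ k) f) differentiable (at x))"

definition double_well :: "(real \<Rightarrow> real) \<Rightarrow> bool" where
  "double_well \<Psi> \<longleftrightarrow>
     smooth \<Psi> \<and> (\<forall>s. 0 \<le> \<Psi> s) \<and> (\<forall>s. \<Psi> (- s) = \<Psi> s) \<and> {s. \<forall>t. \<Psi> s \<le> \<Psi> t} = {-1, 1}"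

definition potential_splitting :: "(real \<Rightarrow> real) \<Rightarrow> (real \<Rightarrow> real) \<Rightarrow> (real \<Rightarrow> real) \<Rightarrow> bool" where
  "potential_splitting \<Psi> \<phi>\<^sub>p \<phi>\<^sub>m \<longleftrightarrow>
     (\<forall>s. deriv \<Psi> s = \<phi>\<^sub>p s + \<phi>\<^sub>m s) \<and>
     (\<forall>s. \<phi>\<^sub>p differentiable (at s) \<and> 0 \<le> deriv \<phi>\<^sub>p s) \<and>
     (\<forall>s. \<phi>\<^sub>m differentiable (at s) \<and> deriv \<phi>\<^sub>m s \<le> 0)"

definition potential_growth :: "(real \<Rightarrow> real) \<Rightarrow> bool" where
  "potential_growth \<phi>\<^sub>p \<longleftrightarrow>
     (\<exists>\<psi>\<^sub>0 \<psi>\<^sub>1 \<delta>. \<psi>\<^sub>0 > 0 \<and> \<psi>\<^sub>1 > 0 \<and> \<delta> > 0 \<and>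
        (\<forall>s. (LBINT y=0..s. \<phi>\<^sub>p y) \<ge> \<psi>\<^sub>1 * \<bar>s\<bar> powr (1 + \<delta>) - \<psi>\<^sub>0))"

definition c_pot :: "(real \<Rightarrow> real) \<Rightarrow> real" where
  "c_pot \<Psi> = (LBINT s=-1..1. sqrt (2 * \<Psi> s))"

section \<open>Discrete energies\<close>

definition energy_E ::
    "(real^'d) set \<Rightarrow> (real^'d) set set \<Rightarrow> real \<Rightarrow> real \<Rightarrow> real \<Rightarrow> real \<Rightarrow> real \<Rightarrow> real \<Rightarrow>
     (real^'d \<Rightarrow> real) \<Rightarrow> (real \<Rightarrow> real) \<Rightarrow> (real^'d \<Rightarrow> real) \<Rightarrow> (real^'d \<Rightarrow> real) \<Rightarrow> real" where
  "energy_E \<Omega> T \<epsilon> \<theta> lam \<alpha> a u\<^sub>D \<gamma> \<Psi> W \<Phi> =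
     \<theta> / 2 * (lumped_norm T (\<lambda>x. W x - u\<^sub>D))\<^sup>2 +
     lam * \<alpha> / a * (1 / c_pot \<Psi>) *
       (1 / 2 * \<epsilon> * (L2_norm \<Omega> (\<lambda>x. \<gamma> (grad \<Phi> x)))\<^sup>2 +
        1 / \<epsilon> * lumped_inner T (\<lambda>x. \<Psi> (\<Phi> x)) (\<lambda>x. 1))"

definition energy_F ::
    "(real^'d) set \<Rightarrow> (real^'d) set set \<Rightarrow> real \<Rightarrow> real \<Rightarrow> real \<Rightarrow> real \<Rightarrow> real \<Rightarrow> real \<Rightarrow>
     (real^'d \<Rightarrow> real) \<Rightarrow> (real \<Rightarrow> real) \<Rightarrow> (real \<Rightarrow> real) \<Rightarrow>
     (real^'d \<Rightarrow> real) \<Rightarrow> (real^'d \<Rightarrow> real) \<Rightarrow> real" where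
  "energy_F \<Omega> T \<epsilon> \<theta> lam \<alpha> a u\<^sub>D \<gamma> \<Psi> shp W \<Phi> =
     energy_E \<Omega> T \<epsilon> \<theta> lam \<alpha> a u\<^sub>D \<gamma> \<Psi> W \<Phi> -
     lam * u\<^sub>D * lumped_inner T (\<lambda>x. shape_primitive shp (\<Phi> x)) (\<lambda>x. 1)"

end

theory Submission
  imports Defs
begin

text \<open>The first equation is tested with \<open>W\<^sup>n - u\<^sub>D\<close> and the second one with \<open>\<Phi>\<^sup>n - \<Phi>\<^sup>n\<^sup>-\<^sup>1\<close>. The coupling
  terms with \<open>W\<^sup>n\<close> cancel once the first equation is multiplied by \<open>\<tau>\<^sub>n\<close> and the second one by
  \<open>\<lambda> \<alpha> / (a c\<^sub>\<Psi>)\<close>. What is left is an identity that consists of the two dissipative terms, the term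
  with \<open>u\<^sub>D\<close>, and three terms that are bounded below by increments of the energy:

  \<^item> \<open>2 (w - v) (w - u) \<ge> (w - u)\<^sup>2 - (v - u)\<^sup>2\<close> for the temperature term;
  \<^item> \<open>B\<^sub>r(q, p) p \<bullet> (p - q) \<ge> (\<gamma> p)\<^sup>2 / 2 - (\<gamma> q)\<^sup>2 / 2\<close> on each simplex for the anisotropic gradient
    term (\<open>anisotropy_matrix_energy\<close>); this rests on the Cauchy-Schwarz inequality for each \<open>G\<^sub>l\<close>
    and on Hoelder's inequality for the sum over \<open>l\<close>;
  \<^item> \<open>(\<phi>\<^sup>+ t + \<phi>\<^sup>- s) (t - s) \<ge> \<Psi> t - \<Psi> s\<close> at each vertex for the potential
    (\<open>potential_splitting_le\<close>), by the mean value theorem and the monotonicity of \<open>\<phi>\<^sup>+\<close> and \<open>\<phi>\<^sup>-\<close>.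

  The estimate for the second energy follows because, by the same argument on the splitting of the
  shape function (\<open>shape_splitting_le\<close>), the term with \<open>u\<^sub>D\<close> is bounded by the increment of the
  primitive.

  Two facts reduce the integrals to finite sums, in which these inequalities are applied termwise.
  The gradients of finite element functions are constant on each simplex and the simplices exhaust
  \<open>\<Omega>\<close> up to a null set (\<open>set_integral_simplexwise_const\<close>); and the lumped inner product is a
  nonnegatively weighted sum of limits at the vertices from within the simplices, which all exist
  (\<open>lumped_inner_eq\<close>).\<close>

section \<open>Anisotropy\<close>

lemma ell_norm_0 [simp]: "ell_norm A 0 = 0"
  by (simp add: ell_norm_def)

lemma ell_norm_pos: "sym_pos_def A \<Longrightarrow> p \<noteq> 0 \<Longrightarrow> 0 < ell_norm A p"
  by (simp add: sym_pos_def_def ell_norm_def)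

lemma ell_norm_power2:
  assumes "sym_pos_def A"
  shows "(ell_norm A p)\<^sup>2 = p \<bullet> (A *v p)"
  using assms by (cases "p = 0") (auto simp: sym_pos_def_def ell_norm_def less_imp_le)

lemma sym_pos_def_commute:
  assumes "sym_pos_def A"
  shows "(A *v p) \<bullet> q = p \<bullet> (A *v q)"
  using assms by (metis dot_lmul_matrix sym_pos_def_def transpose_matrix_vector)

text \<open>The Cauchy-Schwarz inequality of the inner product \<open>p \<bullet> A q\<close>.\<close>

lemma ell_norm_Cauchy_Schwarz:
  assumes A: "sym_pos_def A"
  shows "(A *v p) \<bullet> q \<le> ell_norm A p * ell_norm A q"
proof (cases "p = 0 \<or> q = 0")
  case False
  let ?s = "ell_norm A p" and ?t = "ell_norm A q"
  have st: "0 < ?s * ?t"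
    using ell_norm_pos[OF A] False by simp
  have comm: "(A *v q) \<bullet> p = (A *v p) \<bullet> q"
    by (metis A inner_commute sym_pos_def_commute)
  let ?v = "?t *\<^sub>R p - ?s *\<^sub>R q"
  have "0 \<le> ?v \<bullet> (A *v ?v)"
    using ell_norm_power2[OF A, of ?v] by (metis zero_le_power2)
  also have "\<dots> = ?t\<^sup>2 * (p \<bullet> (A *v p)) + ?s\<^sup>2 * (q \<bullet> (A *v q)) - 2 * (?s * ?t) * ((A *v p) \<bullet> q)"
    by (simp add: matrix_vector_mult_diff_distrib scaleR_matrix_vector_assoc[symmetric]
        matrix_vector_mult_scaleR inner_diff_left inner_diff_right sym_pos_def_commute[OF A, symmetric]
        comm algebra_simps power2_eq_square)
  also have "\<dots> = 2 * (?s * ?t) * (?s * ?t - (A *v p) \<bullet> q)"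
    by (simp only: ell_norm_power2[OF A, symmetric]) (simp add: algebra_simps power2_eq_square)
  finally show ?thesis
    using st by (simp add: zero_le_mult_iff)
qed auto

text \<open>Hoelder's inequality with exponents \<open>(r + 1) / r\<close> and \<open>r + 1\<close>, applied to
  \<open>x\<^sup>r = (x\<^sup>r\<^sup>+\<^sup>1 / y)\<^sup>r\<^sup>/\<^sup>(\<^sup>r\<^sup>+\<^sup>1\<^sup>) (y\<^sup>r)\<^sup>1\<^sup>/\<^sup>(\<^sup>r\<^sup>+\<^sup>1\<^sup>)\<close>, and solved for the sum of the quotients.\<close>

lemma powr_sum_quotient_ge:
  fixes x y :: "'a \<Rightarrow> real"
  assumes I: "finite I" "I \<noteq> {}" and r: "r \<ge> 1"
    and x: "\<And>i. i \<in> I \<Longrightarrow> 0 < x i" and y: "\<And>i. i \<in> I \<Longrightarrow> 0 < y i"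
  defines "P \<equiv> (\<Sum>i\<in>I. x i powr r) powr (1 / r)" and "Q \<equiv> (\<Sum>i\<in>I. y i powr r) powr (1 / r)"
  shows "P powr (r + 1) \<le> Q * (\<Sum>i\<in>I. x i powr (r + 1) / y i)"
proof -
  have sx: "0 < (\<Sum>i\<in>I. x i powr r)" and sy: "0 < (\<Sum>i\<in>I. y i powr r)"
    using I by (auto intro!: sum_pos dest: x y)
  have P: "0 < P" "P powr r = (\<Sum>i\<in>I. x i powr r)"
    and Q: "0 < Q" "Q powr r = (\<Sum>i\<in>I. y i powr r)"
    using sx sy r by (simp_all add: P_def Q_def powr_powr)
  define A where "A i = (x i / P) powr (r + 1) / (y i / Q)" for i
  define B where "B i = (y i / Q) powr r" for i
  have young: "(x i / P) powr r \<le> r / (r + 1) * A i + 1 / (r + 1) * B i" if i: "i \<in> I" for i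
  proof -
    have pos: "0 < x i / P" "0 < y i / Q"
      using P Q x[OF i] y[OF i] by simp_all
    have "A i powr (r / (r + 1)) * B i powr (1 / (r + 1)) = (x i / P) powr r"
    proof -
      define X Y where "X = x i / P" and "Y = y i / Q"
      have "A i powr (r / (r + 1)) = X powr r / Y powr (r / (r + 1))"
        using pos r by (simp add: A_def X_def[symmetric] Y_def[symmetric] powr_divide powr_powr)
      moreover have "B i powr (1 / (r + 1)) = Y powr (r / (r + 1))"
        by (simp add: B_def Y_def[symmetric] powr_powr)
      ultimately show ?thesis
        using pos by (simp add: X_def[symmetric] Y_def[symmetric])
    qed
    moreover have "A i powr (r / (r + 1)) * B i powr (1 / (r + 1)) \<le>
        r / (r + 1) * A i + 1 / (r + 1) * B i"
    proof (rule Youngs_inequality_0)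
      show "r / (r + 1) + 1 / (r + 1) = 1"
        using r by (simp add: add_divide_distrib[symmetric])
      show "0 < A i" "0 < B i"
        unfolding A_def B_def using P Q x[OF i] y[OF i] by simp_all
    qed (use r in auto)
    ultimately show ?thesis by simp
  qed
  have "(\<Sum>i\<in>I. (x i / P) powr r) = (\<Sum>i\<in>I. x i powr r) / P powr r"
    using x P(1) by (simp add: powr_divide sum_divide_distrib less_imp_le)
  then have "(\<Sum>i\<in>I. (x i / P) powr r) = 1"
    unfolding P(2) using sx by (metis divide_self less_irrefl)
  moreover have "(\<Sum>i\<in>I. B i) = (\<Sum>i\<in>I. y i powr r) / Q powr r"
    using y Q(1) by (simp add: B_def powr_divide sum_divide_distrib less_imp_le)
  then have "(\<Sum>i\<in>I. B i) = 1"
    unfolding Q(2) using sy by (metis divide_self less_irrefl)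
  moreover have "(\<Sum>i\<in>I. (x i / P) powr r) \<le> (\<Sum>i\<in>I. r / (r + 1) * A i + 1 / (r + 1) * B i)"
    by (rule sum_mono) (rule young)
  ultimately have "1 \<le> r / (r + 1) * (\<Sum>i\<in>I. A i) + 1 / (r + 1)"
    by (simp add: sum.distrib sum_distrib_left[symmetric] sum_divide_distrib[symmetric])
  then have "1 * (r + 1) \<le> (r / (r + 1) * (\<Sum>i\<in>I. A i) + 1 / (r + 1)) * (r + 1)"
    using r by (intro mult_right_mono) auto
  then have "1 \<le> (\<Sum>i\<in>I. A i)"
    using r by (simp add: distrib_right)
  also have "\<dots> = (Q * (\<Sum>i\<in>I. x i powr (r + 1) / y i)) / P powr (r + 1)"
    using x P Q by (simp add: A_def powr_divide sum_distrib_left sum_divide_distrib less_imp_le mult_ac)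
  finally show ?thesis
    using P by (simp add: field_simps)
qed

lemma anisotropy_pos:
  assumes "L \<ge> 1" "\<forall>l\<in>{1..L}. sym_pos_def (G l)" "p \<noteq> 0"
  shows "0 < anisotropy r L G p"
proof -
  have "0 < (\<Sum>l=1..L. ell_norm (G l) p powr r)"
    using assms by (intro sum_pos) (auto simp: less_imp_neq[OF ell_norm_pos, symmetric])
  then show ?thesis by (simp add: anisotropy_def)
qed

lemma anisotropy_0 [simp]: "anisotropy r L G 0 = 0"
  by (simp add: anisotropy_def)

lemma anisotropy_nonneg: "0 \<le> anisotropy r L G p"
  by (simp add: anisotropy_def)

lemma matrix_vector_mult_sum_left: "(\<Sum>i\<in>I. A i) *v x = (\<Sum>i\<in>I. A i *v x)"
  for A :: "'a \<Rightarrow> real^'n^'m"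
  by (induction I rule: infinite_finite_induct) (auto simp: matrix_vector_mult_add_rdistrib)

text \<open>The proof shows the stronger bound \<open>B\<^sub>r(q, p) p \<bullet> (p - q) \<ge> \<gamma> p (\<gamma> p - \<gamma> q)\<close> for \<open>p \<noteq> 0\<close>. The
  Cauchy-Schwarz inequality for every \<open>G\<^sub>l\<close> reduces it to \<open>powr_sum_quotient_ge\<close> with
  \<open>x\<^sub>l = \<gamma>\<^sub>l p\<close> and \<open>y\<^sub>l = \<gamma>\<^sub>l q\<close>. The case \<open>q = 0\<close> is covered by the choice \<open>y\<^sub>l = 1\<close>, for which the
  factor \<open>L\<^sup>1\<^sup>/\<^sup>r\<close> in the definition of \<open>B\<^sub>r(0, p)\<close> is the \<open>r\<close>-norm of \<open>y\<close>.\<close>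

lemma anisotropy_matrix_energy:
  assumes r: "r \<ge> 1" and L: "L \<ge> 1" and G: "\<forall>l\<in>{1..L}. sym_pos_def (G l)"
  shows "(anisotropy r L G p)\<^sup>2 / 2 - (anisotropy r L G q)\<^sup>2 / 2
       \<le> (anisotropy_matrix r L G q p *v p) \<bullet> (p - q)"
proof (cases "p = 0")
  case False
  define x where "x l = ell_norm (G l) p" for l
  define z where "z l = ell_norm (G l) q" for l
  define y where "y l = (if q = 0 then 1 else z l)" for l
  define P where "P = anisotropy r L G p"
  define Q where "Q = (\<Sum>l=1..L. y l powr r) powr (1 / r)"
  define w where "w l = (x l / P) powr (r - 1) / y l" for l
  have x: "0 < x l" if "l \<in> {1..L}" for l
    using that False G by (auto simp: x_def ell_norm_pos)
  have y: "0 < y l" if "l \<in> {1..L}" for l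
    using that G by (auto simp: y_def z_def ell_norm_pos)
  have P: "0 < P" unfolding P_def by (rule anisotropy_pos) (use L G False in auto)
  have P': "P = (\<Sum>l=1..L. x l powr r) powr (1 / r)"
    by (simp add: P_def anisotropy_def x_def)
  have Pr: "P powr r = (\<Sum>l=1..L. x l powr r)"
    using r by (simp add: P' powr_powr sum_nonneg)
  have Q0: "0 \<le> Q" by (simp add: Q_def)
  have Q: "Q = (if q = 0 then real L powr (1 / r) else anisotropy r L G q)"
    by (simp add: Q_def y_def z_def anisotropy_def)
  have w0: "0 \<le> w l" if "l \<in> {1..L}" for l
    using y[OF that] by (simp add: w_def)
  have B: "anisotropy_matrix r L G q p = Q *\<^sub>R (\<Sum>l=1..L. w l *\<^sub>R G l)"
    using False
    by (simp add: anisotropy_matrix_def Q anisotropy_ratio_def w_def x_def y_def z_def P_def divide_inverse)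
  have lhs: "(anisotropy_matrix r L G q p *v p) \<bullet> (p - q) =
      Q * (\<Sum>l=1..L. w l * ((G l *v p) \<bullet> (p - q)))"
    by (simp add: B scaleR_matrix_vector_assoc[symmetric] matrix_vector_mult_sum_left inner_sum_left
        sum_distrib_left mult_ac)
  have xP: "w l * x l ^ k = P powr (1 - r) * (x l powr (r + k - 1) / y l)" if "l \<in> {1..L}" for l and k :: nat
  proof -
    have "w l * x l ^ k = (x l powr (r - 1) * x l powr (real k)) * P powr (1 - r) / y l"
      using x[OF that] P powr_minus_divide[of P "r - 1"]
      by (simp add: w_def powr_divide powr_realpow)
    also have "x l powr (r - 1) * x l powr (real k) = x l powr (r + k - 1)"
      by (simp add: powr_add[symmetric] algebra_simps)
    finally show ?thesis by simp
  qed
  have "P powr (r + 1) \<le> Q * (\<Sum>l=1..L. x l powr (r + 1) / y l)"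
    unfolding P' Q_def by (rule powr_sum_quotient_ge) (use L r x y in auto)
  then have "P powr (1 - r) * P powr (r + 1) \<le> P powr (1 - r) * (Q * (\<Sum>l=1..L. x l powr (r + 1) / y l))"
    by (rule mult_left_mono) simp
  also have "P powr (1 - r) * P powr (r + 1) = P\<^sup>2"
    using P by (simp add: powr_add[symmetric])
  also have "P powr (1 - r) * (Q * (\<Sum>l=1..L. x l powr (r + 1) / y l)) = Q * (\<Sum>l=1..L. w l * (x l)\<^sup>2)"
    using xP[of _ 2] by (simp add: sum_distrib_left add.commute[of 1 r] mult_ac)
  finally have main: "P\<^sup>2 \<le> Q * (\<Sum>l=1..L. w l * (x l)\<^sup>2)" .
  have "(\<Sum>l=1..L. w l * ((x l)\<^sup>2 - x l * z l)) \<le> (\<Sum>l=1..L. w l * ((G l *v p) \<bullet> (p - q)))"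
  proof (intro sum_mono mult_left_mono w0)
    fix l assume l: "l \<in> {1..L}"
    then show "(x l)\<^sup>2 - x l * z l \<le> (G l *v p) \<bullet> (p - q)"
      using ell_norm_Cauchy_Schwarz[of "G l" p q] G
      by (simp add: inner_diff_right x_def z_def ell_norm_power2 inner_commute[of p])
  qed
  then have "Q * (\<Sum>l=1..L. w l * ((x l)\<^sup>2 - x l * z l)) \<le> (anisotropy_matrix r L G q p *v p) \<bullet> (p - q)"
    unfolding lhs by (rule mult_left_mono) (rule Q0)
  moreover have "Q * (\<Sum>l=1..L. w l * ((x l)\<^sup>2 - x l * z l)) =
      Q * (\<Sum>l=1..L. w l * (x l)\<^sup>2) - Q * (\<Sum>l=1..L. w l * x l * z l)"
    by (simp add: right_diff_distrib sum_subtractf mult_ac)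
  moreover have "Q * (\<Sum>l=1..L. w l * x l * z l) = anisotropy r L G q * P"
  proof (cases "q = 0")
    case True
    then show ?thesis by (simp add: z_def)
  next
    case False
    have "w l * x l * z l = P powr (1 - r) * x l powr r" if "l \<in> {1..L}" for l
      using xP[OF that, of 1] y[OF that] False by (simp add: y_def)
    then have "(\<Sum>l=1..L. w l * x l * z l) = P powr (1 - r) * P powr r"
      by (simp add: Pr sum_distrib_left)
    also have "\<dots> = P"
      using P by (simp add: powr_add[symmetric])
    finally show ?thesis using False by (simp add: Q)
  qed
  ultimately have "P\<^sup>2 - anisotropy r L G q * P \<le> (anisotropy_matrix r L G q p *v p) \<bullet> (p - q)"
    using main by linarith
  moreover have "P\<^sup>2 / 2 - (anisotropy r L G q)\<^sup>2 / 2 \<le> P\<^sup>2 - anisotropy r L G q * P"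
    using zero_le_power2[of "P - anisotropy r L G q"] by (simp add: power2_diff algebra_simps)
  ultimately show ?thesis by (simp add: P_def)
qed simp

lemma kinetic_mobility_nonneg:
  assumes \<gamma>: "\<And>p. 0 \<le> \<gamma> p" and \<beta>: "kinetic_coefficient \<beta>" and \<mu>: "mobility_constant_ok \<gamma> \<beta> \<mu>\<^sub>0"
  shows "0 \<le> kinetic_mobility \<gamma> \<beta> \<mu>\<^sub>0 p"
proof -
  have quot: "0 \<le> \<gamma> p / \<beta> p" for p
    using \<gamma> \<beta> by (simp add: kinetic_coefficient_def)
  have "0 \<le> (INF p\<in>-{0}. ereal (\<gamma> p / \<beta> p))"
    by (rule INF_greatest) (use quot in simp)
  also have "\<dots> \<le> ereal \<mu>\<^sub>0"
    using \<mu> by (simp add: mobility_constant_ok_def)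
  finally show ?thesis
    using quot by (simp add: kinetic_mobility_def)
qed

section \<open>One-dimensional calculus\<close>

lemma interval_integral_has_real_derivative:
  fixes f :: "real \<Rightarrow> real"
  assumes "continuous_on UNIV f"
  shows "((\<lambda>u. LBINT y=ereal c..ereal u. f y) has_real_derivative f x) (at x)"
proof -
  define l where "l = min c x - 1"
  define u where "u = max c x + 1"
  have mem: "l < c" "c < u" "l < x" "x < u"
    unfolding l_def u_def by linarith+
  have "((\<lambda>u. LBINT y=ereal c..ereal u. f y) has_vector_derivative f x) (at x within {l..u})"
    by (rule interval_integral_FTC2) (use mem continuous_on_subset[OF assms] in simp_all)
  moreover have "at x within {l..u} = at x"
    using mem by (intro at_within_interior) (simp add: interior_atLeastAtMost_real)
  ultimately show ?thesis
    by (simp only: has_real_derivative_iff_has_vector_derivative)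
qed

lemma mvt_segment:
  fixes f f' :: "real \<Rightarrow> real"
  assumes "\<And>s. (f has_real_derivative f' s) (at s)"
  obtains \<xi> where "\<xi> \<in> closed_segment s t" "f t - f s = f' \<xi> * (t - s)"
proof (cases s t rule: linorder_cases)
  case less
  from MVT2[OF less, of f f'] assms obtain z where "s < z" "z < t" "f t - f s = (t - s) * f' z"
    by blast
  then show thesis using less by (intro that[of z]) (auto simp: closed_segment_eq_real_ivl)
next
  case equal
  then show thesis by (intro that[of s]) auto
next
  case greater
  from MVT2[OF greater, of f f'] assms obtain z where "t < z" "z < s" "f s - f t = (s - t) * f' z"
    by blast
  then show thesis using greater
    by (intro that[of z]) (auto simp: closed_segment_eq_real_ivl algebra_simps)
qed

text \<open>The semi-implicit treatment of a splitting: with the nondecreasing part of \<open>f'\<close> taken at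
  the new value \<open>t\<close> and the nonincreasing part at the old value \<open>s\<close>, the discrete chain rule holds
  with an inequality.\<close>

lemma convex_concave_splitting_le:
  fixes f f' g h :: "real \<Rightarrow> real"
  assumes f: "\<And>s. (f has_real_derivative f' s) (at s)" and f': "\<And>s. f' s = g s + h s"
    and S: "closed_segment s t \<subseteq> S" and g: "mono_on S g" and h: "antimono_on S h"
  shows "f t - f s \<le> (g t + h s) * (t - s)"
proof -
  obtain \<xi> where \<xi>: "\<xi> \<in> closed_segment s t" and eq: "f t - f s = f' \<xi> * (t - s)"
    using mvt_segment[OF f] .
  have mem: "s \<in> S" "t \<in> S" "\<xi> \<in> S" using S \<xi> by auto
  show ?thesis
  proof (cases "s \<le> t")
    case True
    then have "s \<le> \<xi>" "\<xi> \<le> t" using \<xi> by (auto simp: closed_segment_eq_real_ivl)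
    then have "g \<xi> \<le> g t" "h \<xi> \<le> h s"
      using mono_onD[OF g] monotone_onD[OF h] mem by auto
    then have "f' \<xi> \<le> g t + h s" by (simp add: f')
    then show ?thesis unfolding eq using True by (intro mult_right_mono) auto
  next
    case False
    then have "t \<le> \<xi>" "\<xi> \<le> s" using \<xi> by (auto simp: closed_segment_eq_real_ivl)
    then have "g t \<le> g \<xi>" "h s \<le> h \<xi>"
      using mono_onD[OF g] monotone_onD[OF h] mem by auto
    then have "g t + h s \<le> f' \<xi>" by (simp add: f')
    then show ?thesis unfolding eq using False by (intro mult_right_mono_neg) auto
  qed
qed

lemma mono_on_deriv_nonneg:
  fixes f :: "real \<Rightarrow> real"
  assumes S: "is_interval S" and f: "\<And>s. s \<in> S \<Longrightarrow> f differentiable at s"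
    and f': "\<And>s. s \<in> S \<Longrightarrow> 0 \<le> deriv f s"
  shows "mono_on S f"
proof (rule mono_onI)
  fix s t assume st: "s \<in> S" "t \<in> S" "s \<le> t"
  have "u \<in> S" if "s \<le> u" "u \<le> t" for u
    using mem_is_interval_1_I[OF S] st that by blast
  then show "f s \<le> f t"
    using st(3) f f'
    by (meson DERIV_nonneg_imp_nondecreasing DERIV_deriv_iff_real_differentiable)
qed

lemma antimono_on_deriv_nonpos:
  fixes f :: "real \<Rightarrow> real"
  assumes S: "is_interval S" and f: "\<And>s. s \<in> S \<Longrightarrow> f differentiable at s"
    and f': "\<And>s. s \<in> S \<Longrightarrow> deriv f s \<le> 0"
  shows "antimono_on S f"
proof (rule monotone_onI)
  fix s t assume st: "s \<in> S" "t \<in> S" "s \<le> t"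
  have "u \<in> S" if "s \<le> u" "u \<le> t" for u
    using mem_is_interval_1_I[OF S] st that by blast
  then show "f t \<le> f s"
    using st(3) f f'
    by (meson DERIV_nonpos_imp_nonincreasing DERIV_deriv_iff_real_differentiable)
qed

lemma double_well_has_deriv:
  assumes "double_well \<Psi>"
  shows "(\<Psi> has_real_derivative deriv \<Psi> s) (at s)"
proof -
  have "((deriv ^^ 0) \<Psi>) differentiable at s"
    using assms unfolding double_well_def smooth_def by blast
  then show ?thesis by (simp add: DERIV_deriv_iff_real_differentiable)
qed

text \<open>The mean value theorem gives \<open>c\<^sub>\<Psi> = 2 sqrt (2 \<Psi> z)\<close> with \<open>\<bar>z\<bar> < 1\<close>, and \<open>\<Psi>\<close> attains its
  nonnegative minimum only at \<open>-1\<close> and \<open>1\<close>.\<close>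

lemma c_pot_pos:
  assumes "double_well \<Psi>"
  shows "0 < c_pot \<Psi>"
proof -
  have pos: "0 < \<Psi> s" if "s \<noteq> 1" "s \<noteq> -1" for s
  proof -
    have "s \<notin> {s. \<forall>t. \<Psi> s \<le> \<Psi> t}"
      using assms that unfolding double_well_def by auto
    then obtain t where "\<Psi> t < \<Psi> s" by (auto simp: not_le)
    moreover have "0 \<le> \<Psi> t" using assms by (simp add: double_well_def)
    ultimately show ?thesis by linarith
  qed
  have "continuous_on UNIV \<Psi>"
    by (rule DERIV_continuous_on[where D = "deriv \<Psi>"]) (rule double_well_has_deriv[OF assms])
  then have cont: "continuous_on UNIV (\<lambda>s. sqrt (2 * \<Psi> s))"
    by (intro continuous_intros)
  let ?F = "\<lambda>u. LBINT s=ereal (-1)..ereal u. sqrt (2 * \<Psi> s)"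
  obtain z where z: "-1 < z" "z < 1" "?F 1 - ?F (-1) = (1 - (-1)) * sqrt (2 * \<Psi> z)"
    using MVT2[of "-1" 1 ?F "\<lambda>s. sqrt (2 * \<Psi> s)"] interval_integral_has_real_derivative[OF cont]
    by auto
  have "c_pot \<Psi> = ?F 1 - ?F (-1)"
    by (simp add: c_pot_def one_ereal_def)
  then show ?thesis using z pos[of z] by simp
qed

lemma potential_splitting_le:
  assumes dw: "double_well \<Psi>" and sp: "potential_splitting \<Psi> \<phi>\<^sub>p \<phi>\<^sub>m"
  shows "\<Psi> t - \<Psi> s \<le> (\<phi>\<^sub>p t + \<phi>\<^sub>m s) * (t - s)"
proof (rule convex_concave_splitting_le[where S = UNIV])
  show "(\<Psi> has_real_derivative deriv \<Psi> s) (at s)" for s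
    by (rule double_well_has_deriv[OF dw])
  show "deriv \<Psi> s = \<phi>\<^sub>p s + \<phi>\<^sub>m s" for s
    using sp unfolding potential_splitting_def by blast
  show "mono_on UNIV \<phi>\<^sub>p"
    by (rule mono_on_deriv_nonneg) (use sp in \<open>auto simp only: potential_splitting_def is_interval_univ\<close>)
  show "antimono_on UNIV \<phi>\<^sub>m"
    by (rule antimono_on_deriv_nonpos) (use sp in \<open>auto simp only: potential_splitting_def is_interval_univ\<close>)
qed auto

lemma C1_UNIV_differentiable:
  fixes f :: "real \<Rightarrow> real"
  shows "f C1_differentiable_on UNIV \<Longrightarrow> f differentiable at s"
  by (simp add: C1_differentiable_on_eq)

lemma C1_UNIV_isCont:
  fixes f :: "real \<Rightarrow> real"
  shows "f C1_differentiable_on UNIV \<Longrightarrow> isCont f s"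
  by (simp add: C1_UNIV_differentiable differentiable_imp_continuous_within)

lemma shape_primitive_has_deriv:
  assumes "shape_function f"
  shows "(shape_primitive f has_real_derivative f s) (at s)"
proof -
  have "continuous_on UNIV f"
    using assms by (auto simp: shape_function_def intro!: continuous_at_imp_continuous_on C1_UNIV_isCont)
  from interval_integral_has_real_derivative[OF this, of "-1" s] show ?thesis
    by (simp add: shape_primitive_def[abs_def] one_ereal_def)
qed

text \<open>For the shape function the monotonicity of the splitting is reversed, which is compensated by
  the sign with which the term enters the energy.\<close>

lemma shape_splitting_le:
  assumes shp: "shape_function f" "shape_splitting f f\<^sub>p f\<^sub>m"
    and S: "is_interval S" "s \<in> S" "t \<in> S"
    and mon: "\<And>s. s \<in> S \<Longrightarrow> u * deriv f\<^sub>p s \<le> 0 \<and> - u * deriv f\<^sub>m s \<le> 0"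
  shows "u * ((f\<^sub>m s + f\<^sub>p t) * (t - s)) \<le> u * (shape_primitive f t - shape_primitive f s)"
proof -
  have C1: "f\<^sub>p differentiable at s" "f\<^sub>m differentiable at s" for s
    using shp by (auto simp: shape_splitting_def C1_UNIV_differentiable)
  have d: "((\<lambda>s. - u * f\<^sub>p s) has_real_derivative - u * deriv f\<^sub>p s) (at s)"
    "((\<lambda>s. - u * f\<^sub>m s) has_real_derivative - u * deriv f\<^sub>m s) (at s)" for s
    by (rule DERIV_cmult, simp add: C1 DERIV_deriv_iff_real_differentiable)+
  have "- u * shape_primitive f t - - u * shape_primitive f s
      \<le> ((- u * f\<^sub>p t) + (- u * f\<^sub>m s)) * (t - s)"
  proof (rule convex_concave_splitting_le[where S = S])
    show "((\<lambda>s. - u * shape_primitive f s) has_real_derivative - u * f s) (at s)" for s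
      by (intro DERIV_cmult shape_primitive_has_deriv shp)
    show "- u * f s = - u * f\<^sub>p s + - u * f\<^sub>m s" for s
      using shp by (simp add: shape_splitting_def algebra_simps)
    show "closed_segment s t \<subseteq> S"
      using S by (meson closed_segment_subset is_interval_convex)
    show "mono_on S (\<lambda>s. - u * f\<^sub>p s)"
    proof (rule mono_on_deriv_nonneg[OF S(1)])
      show "(\<lambda>s. - u * f\<^sub>p s) differentiable at s" for s
        using d(1) real_differentiable_def by blast
      show "0 \<le> deriv (\<lambda>s. - u * f\<^sub>p s) s" if "s \<in> S" for s
        using mon[OF that] DERIV_imp_deriv[OF d(1), of s] by simp
    qed
    show "antimono_on S (\<lambda>s. - u * f\<^sub>m s)"
    proof (rule antimono_on_deriv_nonpos[OF S(1)])
      show "(\<lambda>s. - u * f\<^sub>m s) differentiable at s" for s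
        using d(2) real_differentiable_def by blast
      show "deriv (\<lambda>s. - u * f\<^sub>m s) s \<le> 0" if "s \<in> S" for s
        using mon[OF that] DERIV_imp_deriv[OF d(2), of s] by simp
    qed
  qed
  then show ?thesis by (simp add: algebra_simps)
qed

lemma isCont_trunc_at:
  assumes "m \<ge> 0" "f C1_differentiable_on UNIV"
  shows "isCont (trunc_at m f) s"
proof -
  have eq: "trunc_at m f = (\<lambda>s. f (max (- m) (min m s)))"
    using assms(1) by (auto simp: trunc_at_def fun_eq_iff max_def min_def intro: arg_cong[where f = f])
  have "isCont (\<lambda>s. f (max (- m) (min m s))) s"
  proof (rule isCont_o2[where g = f])
    show "isCont (\<lambda>s. max (- m) (min m s)) s"
      by (intro continuous_intros)
  qed (rule C1_UNIV_isCont[OF assms(2)])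
  then show ?thesis by (simp add: eq)
qed

section \<open>Finite element functions and their gradients\<close>

lemma gderiv_unique: "GDERIV f x :> D \<Longrightarrow> GDERIV f x :> E \<Longrightarrow> D = E"
  unfolding gderiv_def
  by (metis has_derivative_unique inner_commute vector_eq_ldot)

lemma grad_eqI: "GDERIV f x :> D \<Longrightarrow> grad f x = D"
  unfolding grad_def by (blast intro: gderiv_unique)

lemma grad_diff_const: "grad (\<lambda>x. f x - c) = grad f"
proof -
  have "GDERIV (\<lambda>x. f x - c) x :> D \<longleftrightarrow> GDERIV f x :> D" for x D
    using GDERIV_add[of "\<lambda>x. f x - c" x D "\<lambda>x. c" 0] GDERIV_diff[of f x D "\<lambda>x. c" 0]
    by (auto simp: GDERIV_const)
  then show ?thesis by (simp add: grad_def fun_eq_iff)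
qed

lemma gderiv_affine:
  assumes "open S" "x \<in> S" "\<And>y. y \<in> S \<Longrightarrow> f y = g \<bullet> y + c"
  shows "GDERIV f x :> g"
proof -
  have "((\<lambda>y. g \<bullet> y + c) has_derivative (\<lambda>h. h \<bullet> g)) (at x)"
    by (auto intro!: derivative_eq_intros simp: inner_commute)
  then show ?thesis
    unfolding gderiv_def
    by (rule has_derivative_transform_within_open) (use assms in auto)
qed

lemma simplicial_partition_open: "simplicial_partition \<Omega> T \<Longrightarrow> \<sigma> \<in> T \<Longrightarrow> open \<sigma>"
  and simplicial_partition_subset: "simplicial_partition \<Omega> T \<Longrightarrow> \<sigma> \<in> T \<Longrightarrow> \<sigma> \<subseteq> \<Omega>"
  by (auto simp: simplicial_partition_def)

lemma simplicial_partition_convex: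
  assumes "simplicial_partition \<Omega> T" "\<sigma> \<in> T"
  shows "convex \<sigma>"
proof -
  obtain K where "int CARD('a) simplex K" "\<sigma> = interior K"
    using assms unfolding simplicial_partition_def by blast
  then show ?thesis by (simp add: convex_simplex convex_interior)
qed

lemma simplicial_partition_finite:
  assumes "simplicial_partition \<Omega> T"
  shows "finite T"
proof (rule finite_imageD)
  show "finite (closure ` T)"
    using assms by (simp add: simplicial_partition_def triangulation_def)
  have "interior (closure \<sigma>) = \<sigma>" if "\<sigma> \<in> T" for \<sigma>
    using simplicial_partition_convex[OF assms that] simplicial_partition_open[OF assms that]
    by (simp add: convex_interior_closure interior_open)
  then show "inj_on closure T" by (metis inj_onI)
qed

lemma fe_space_const: "(\<lambda>x :: real^'d. c) \<in> fe_space \<Omega> T"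
proof -
  have "\<forall>x\<in>\<sigma>. c = 0 \<bullet> x + c" for \<sigma> :: "(real^'d) set"
    by simp
  then have "\<forall>\<sigma>\<in>T. \<exists>g e. \<forall>x\<in>\<sigma>. c = g \<bullet> x + e"
    by blast
  then show ?thesis
    unfolding fe_space_def mem_Collect_eq by (intro conjI continuous_on_const)
qed

lemma fe_space_diff:
  assumes "\<eta> \<in> fe_space \<Omega> T" "\<zeta> \<in> fe_space \<Omega> T"
  shows "(\<lambda>x. \<eta> x - \<zeta> x) \<in> fe_space \<Omega> T"
proof -
  have "\<exists>g c. \<forall>x\<in>\<sigma>. \<eta> x - \<zeta> x = g \<bullet> x + c" if \<sigma>: "\<sigma> \<in> T" for \<sigma>
  proof -
    obtain g c h e where "\<forall>x\<in>\<sigma>. \<eta> x = g \<bullet> x + c" "\<forall>x\<in>\<sigma>. \<zeta> x = h \<bullet> x + e"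
      using assms \<sigma> unfolding fe_space_def by blast
    then have "\<forall>x\<in>\<sigma>. \<eta> x - \<zeta> x = (g - h) \<bullet> x + (c - e)"
      by (simp add: inner_diff_left)
    then show ?thesis by blast
  qed
  moreover have "continuous_on (closure \<Omega>) (\<lambda>x. \<eta> x - \<zeta> x)"
    using assms by (intro continuous_on_diff) (simp_all add: fe_space_def)
  ultimately show ?thesis
    unfolding fe_space_def by blast
qed

lemma fe_space_grad:
  assumes "simplicial_partition \<Omega> T" "\<eta> \<in> fe_space \<Omega> T"
  obtains g where "\<And>\<sigma> x. \<sigma> \<in> T \<Longrightarrow> x \<in> \<sigma> \<Longrightarrow> GDERIV \<eta> x :> g \<sigma>"
proof -
  have "\<forall>\<sigma>\<in>T. \<exists>g. \<forall>x\<in>\<sigma>. GDERIV \<eta> x :> g"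
  proof
    fix \<sigma> assume \<sigma>: "\<sigma> \<in> T"
    then obtain g c where "\<forall>x\<in>\<sigma>. \<eta> x = g \<bullet> x + c"
      using assms(2) unfolding fe_space_def by blast
    then have "\<forall>x\<in>\<sigma>. GDERIV \<eta> x :> g"
      using gderiv_affine[OF simplicial_partition_open[OF assms(1) \<sigma>], of _ \<eta> g c] by blast
    then show "\<exists>g. \<forall>x\<in>\<sigma>. GDERIV \<eta> x :> g" by blast
  qed
  then show thesis using that by metis
qed

text \<open>The mesh covers \<open>\<Omega>\<close> up to the frontiers of the simplices, which are null sets because the
  simplices are convex.\<close>

lemma set_integral_simplexwise_const:
  fixes f :: "real^'d \<Rightarrow> real"
  assumes mesh: "simplicial_partition \<Omega> T" and bdd: "bounded \<Omega>"
    and f: "\<And>\<sigma> x. \<sigma> \<in> T \<Longrightarrow> x \<in> \<sigma> \<Longrightarrow> f x = c \<sigma>"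
  shows "(LINT x:\<Omega>|lebesgue. f x) = (\<Sum>\<sigma>\<in>T. measure lebesgue \<sigma> * c \<sigma>)"
proof -
  have fin: "finite T" by (rule simplicial_partition_finite[OF mesh])
  have lm: "\<sigma> \<in> lmeasurable" if "\<sigma> \<in> T" for \<sigma>
    using that bdd by (meson bounded_subset lmeasurable_open mesh simplicial_partition_open simplicial_partition_subset)
  define h where "h x = (\<Sum>\<sigma>\<in>T. indicator \<sigma> x *\<^sub>R c \<sigma>)" for x
  have int: "integrable lebesgue (\<lambda>x. indicator \<sigma> x *\<^sub>R c \<sigma>)" if "\<sigma> \<in> T" for \<sigma>
    using lm[OF that] by (intro integrable_scaleR_left integrable_real_indicator) (auto simp: fmeasurable_def)
  have h_int: "integrable lebesgue h"
    unfolding h_def[abs_def] by (intro Bochner_Integration.integrable_sum int)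
  have h_val: "h x = c \<sigma>" if "\<sigma> \<in> T" "x \<in> \<sigma>" for \<sigma> x
  proof -
    have "x \<notin> \<sigma>'" if "\<sigma>' \<in> T - {\<sigma>}" for \<sigma>'
      using mesh that \<open>\<sigma> \<in> T\<close> \<open>x \<in> \<sigma>\<close>
      unfolding simplicial_partition_def pairwise_def disjnt_iff by blast
    then have 0: "(\<Sum>\<sigma>'\<in>T - {\<sigma>}. indicator \<sigma>' x *\<^sub>R c \<sigma>') = 0"
      by (intro sum.neutral) auto
    then show ?thesis
      unfolding h_def sum.remove[OF fin that(1)] 0 using that by simp
  qed
  have null: "(\<Union>\<sigma>\<in>T. frontier \<sigma>) \<in> null_sets lebesgue"
    using fin simplicial_partition_convex[OF mesh]
    by (auto simp flip: negligible_iff_null_sets intro!: negligible_Union negligible_convex_frontier)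
  have "\<Omega> \<subseteq> (\<Union>\<sigma>\<in>T. \<sigma>) \<union> (\<Union>\<sigma>\<in>T. frontier \<sigma>)"
  proof
    fix x assume "x \<in> \<Omega>"
    then obtain \<sigma> where "\<sigma> \<in> T" "x \<in> closure \<sigma>"
      using closure_subset[of \<Omega>] mesh by (auto simp: simplicial_partition_def)
    then show "x \<in> (\<Union>\<sigma>\<in>T. \<sigma>) \<union> (\<Union>\<sigma>\<in>T. frontier \<sigma>)"
      by (auto simp: closure_Un_frontier)
  qed
  then have eq: "h x = indicator \<Omega> x *\<^sub>R f x" if "x \<notin> (\<Union>\<sigma>\<in>T. frontier \<sigma>)" for x
  proof (cases "x \<in> \<Omega>")
    case True
    then obtain \<sigma> where "\<sigma> \<in> T" "x \<in> \<sigma>"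
      using \<open>\<Omega> \<subseteq> _\<close> \<open>x \<notin> _\<close> by blast
    then show ?thesis using True by (simp add: h_val f)
  next
    case False
    then have "x \<notin> \<sigma>" if "\<sigma> \<in> T" for \<sigma>
      using simplicial_partition_subset[OF mesh that] by blast
    then have "h x = 0" unfolding h_def by (intro sum.neutral) auto
    then show ?thesis using False by simp
  qed
  have ae: "AE x in lebesgue. h x = indicator \<Omega> x *\<^sub>R f x"
    using null by (rule AE_I') (use eq in auto)
  have meas: "h \<in> borel_measurable lebesgue"
    using h_int by simp
  have "(LINT x:\<Omega>|lebesgue. f x) = integral\<^sup>L lebesgue h"
    unfolding set_lebesgue_integral_def
    by (rule integral_cong_AE[symmetric]) (use ae meas borel_measurable_AE[OF meas ae] in auto)
  also have "\<dots> = (\<Sum>\<sigma>\<in>T. measure lebesgue \<sigma> * c \<sigma>)"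
    unfolding h_def[abs_def] using int lm by (simp add: Bochner_Integration.integral_sum)
  finally show ?thesis .
qed

section \<open>Mass lumping\<close>

text \<open>The lumped quadrature of vertex values. The value \<open>v \<sigma> p\<close> may depend on the simplex \<open>\<sigma>\<close>, since
  the limits of a discontinuous function at a common vertex depend on the adjacent simplex.\<close>

definition lumped_sum :: "(real^'d) set set \<Rightarrow> ((real^'d) set \<Rightarrow> real^'d \<Rightarrow> real) \<Rightarrow> real" where
  "lumped_sum T v = (\<Sum>\<sigma>\<in>T. measure lebesgue \<sigma> / (real CARD('d) + 1) * (\<Sum>p\<in>vertices \<sigma>. v \<sigma> p))"

lemma lumped_sum_add: "lumped_sum T (\<lambda>\<sigma> p. v \<sigma> p + w \<sigma> p) = lumped_sum T v + lumped_sum T w"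
  by (simp add: lumped_sum_def sum.distrib distrib_left)

lemma lumped_sum_diff: "lumped_sum T (\<lambda>\<sigma> p. v \<sigma> p - w \<sigma> p) = lumped_sum T v - lumped_sum T w"
  by (simp add: lumped_sum_def sum_subtractf right_diff_distrib)

lemma lumped_sum_cmult: "lumped_sum T (\<lambda>\<sigma> p. c * v \<sigma> p) = c * lumped_sum T v"
  by (simp add: lumped_sum_def sum_distrib_left mult_ac)

lemma lumped_sum_mono:
  assumes "\<And>\<sigma> p. \<sigma> \<in> T \<Longrightarrow> p \<in> vertices \<sigma> \<Longrightarrow> v \<sigma> p \<le> w \<sigma> p"
  shows "lumped_sum T v \<le> lumped_sum T w"
  unfolding lumped_sum_def
  by (intro sum_mono mult_left_mono) (use assms in auto)

lemma lumped_sum_nonneg: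
  assumes "\<And>\<sigma> p. \<sigma> \<in> T \<Longrightarrow> p \<in> vertices \<sigma> \<Longrightarrow> 0 \<le> v \<sigma> p"
  shows "0 \<le> lumped_sum T v"
  using lumped_sum_mono[of T "\<lambda>_ _. 0" v] assms by (simp add: lumped_sum_def)

lemma vertex_islimpt:
  assumes mesh: "simplicial_partition \<Omega> T" and \<sigma>: "\<sigma> \<in> T" and p: "p \<in> vertices \<sigma>"
  shows "p islimpt \<sigma>"
proof -
  have "p \<in> closure \<sigma>"
    using p by (auto simp: vertices_def extreme_point_of_def)
  then show ?thesis
    using interior_limit_point[of p \<sigma>] simplicial_partition_open[OF mesh \<sigma>]
    by (auto simp: closure_def interior_open)
qed

lemma lumped_inner_eq:
  assumes mesh: "simplicial_partition \<Omega> T"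
    and lim: "\<And>\<sigma> p. \<sigma> \<in> T \<Longrightarrow> p \<in> vertices \<sigma> \<Longrightarrow> ((\<lambda>x. f x * g x) \<longlongrightarrow> v \<sigma> p) (at p within \<sigma>)"
  shows "lumped_inner T f g = lumped_sum T v"
proof -
  have "Lim (at p within \<sigma>) (\<lambda>x. f x * g x) = v \<sigma> p" if "\<sigma> \<in> T" "p \<in> vertices \<sigma>" for \<sigma> p
    using vertex_islimpt[OF mesh that] lim[OF that]
    by (intro tendsto_Lim) (auto simp: trivial_limit_within)
  then show ?thesis by (simp add: lumped_inner_def lumped_sum_def)
qed

lemma lumped_norm_power2:
  assumes "simplicial_partition \<Omega> T"
    and "\<And>\<sigma> p. \<sigma> \<in> T \<Longrightarrow> p \<in> vertices \<sigma> \<Longrightarrow> (f \<longlongrightarrow> v \<sigma> p) (at p within \<sigma>)"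
  shows "(lumped_norm T f)\<^sup>2 = lumped_sum T (\<lambda>\<sigma> p. (v \<sigma> p)\<^sup>2)"
proof -
  have "lumped_inner T f f = lumped_sum T (\<lambda>\<sigma> p. (v \<sigma> p)\<^sup>2)"
    unfolding power2_eq_square by (rule lumped_inner_eq) (use assms in \<open>auto intro!: tendsto_mult\<close>)
  then show ?thesis by (simp add: lumped_norm_def lumped_sum_nonneg)
qed

lemma fe_space_tendsto_vertex:
  assumes mesh: "simplicial_partition \<Omega> T" and \<eta>: "\<eta> \<in> fe_space \<Omega> T"
    and \<sigma>: "\<sigma> \<in> T" and p: "p \<in> vertices \<sigma>"
  shows "(\<eta> \<longlongrightarrow> \<eta> p) (at p within \<sigma>)"
proof -
  have "p \<in> closure \<Omega>" "\<sigma> \<subseteq> closure \<Omega>"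
    using p \<sigma> simplicial_partition_subset[OF mesh \<sigma>] closure_subset[of \<Omega>] closure_mono[of \<sigma> \<Omega>]
    by (auto simp: vertices_def extreme_point_of_def)
  then show ?thesis
    using \<eta> by (auto simp: fe_space_def continuous_on_def intro: tendsto_within_subset)
qed

text \<open>Bounds in the open set \<open>\<Omega>\<close> extend to all vertices of the mesh.\<close>

lemma vertex_value_in_closed:
  assumes mesh: "simplicial_partition \<Omega> T" and \<eta>: "\<eta> \<in> fe_space \<Omega> T"
    and S: "closed S" "\<And>x. x \<in> \<Omega> \<Longrightarrow> \<eta> x \<in> S"
    and \<sigma>: "\<sigma> \<in> T" and p: "p \<in> vertices \<sigma>"
  shows "\<eta> p \<in> S"
proof (rule Lim_in_closed_set[OF S(1)])
  show "\<forall>\<^sub>F x in at p within \<sigma>. \<eta> x \<in> S"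
    using S(2) simplicial_partition_subset[OF mesh \<sigma>] by (auto simp: eventually_at_filter intro!: always_eventually)
  show "at p within \<sigma> \<noteq> bot"
    using vertex_islimpt[OF mesh \<sigma> p] by (simp add: trivial_limit_within)
  show "(\<eta> \<longlongrightarrow> \<eta> p) (at p within \<sigma>)"
    by (rule fe_space_tendsto_vertex) fact+
qed

section \<open>Energy estimate\<close>

theorem theorem3p10:
  fixes \<Omega> bN bD :: "(real^'d) set"
    and T :: "(real^'d) set set"
    and \<epsilon> \<theta> lam \<rho> \<alpha> a Kp Km u\<^sub>D r m \<mu>\<^sub>0 :: real
    and L n :: nat
    and G :: "nat \<Rightarrow> real^'d^'d"
    and \<gamma> \<beta> \<mu> :: "real^'d \<Rightarrow> real"
    and shp shp\<^sub>p shp\<^sub>m \<Psi> \<phi>\<^sub>p \<phi>\<^sub>m :: "real \<Rightarrow> real"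
    and \<tau> :: "nat \<Rightarrow> real"
    and \<Phi> W :: "nat \<Rightarrow> real^'d \<Rightarrow> real"
    and b\<^sub>h :: "real^'d \<Rightarrow> real"
    and d\<Phi> :: "real^'d \<Rightarrow> real"
    and \<rho>\<^sub>h :: "real^'d \<Rightarrow> real"
  assumes dim: "CARD('d) \<in> {2, 3}"
    and domain: "polyhedral_domain \<Omega>"
    and boundary: "boundary_configuration \<Omega> bN bD"
    and Neumann_case: "frontier \<Omega> = bN \<longrightarrow> u\<^sub>D = 0"
    and mesh: "simplicial_partition \<Omega> T"
    and parameters: "\<epsilon> > 0" "\<theta> \<ge> 0" "lam > 0" "\<rho> \<ge> 0" "\<alpha> > 0" "a > 0" "Kp > 0" "Km > 0"
    and r: "r \<ge> 1" and L: "L \<ge> 1" and G: "\<forall>l\<in>{1..L}. sym_pos_def (G l)"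
    and \<gamma>: "\<gamma> = anisotropy r L G"
    and \<beta>: "kinetic_coefficient \<beta>"
    and \<mu>\<^sub>0: "mobility_constant_ok \<gamma> \<beta> \<mu>\<^sub>0"
    and \<mu>: "\<mu> = kinetic_mobility \<gamma> \<beta> \<mu>\<^sub>0"
    and shp: "shape_function shp" "shape_splitting shp shp\<^sub>p shp\<^sub>m" and m: "m \<ge> 2"
    and \<Psi>: "double_well \<Psi>" "potential_splitting \<Psi> \<phi>\<^sub>p \<phi>\<^sub>m" "potential_growth \<phi>\<^sub>p"
    and step: "n \<ge> 1" "\<tau> n > 0"
    and previous_\<Phi>: "\<Phi> 0 \<in> fe_space_bounded \<Omega> T" "n \<ge> 2 \<longrightarrow> \<Phi> (n - 1) \<in> fe_space \<Omega> T"
    and previous_W: "\<theta> \<noteq> 0 \<longrightarrow> W (n - 1) \<in> fe_space_Dirichlet \<Omega> T bD u\<^sub>D"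
    and b\<^sub>h: "b\<^sub>h = nodal_interpolant \<Omega> T (\<lambda>x. trunc_conductivity Kp Km (\<Phi> (n - 1) x))"
    and d\<Phi>: "d\<Phi> = (\<lambda>x. (\<Phi> n x - \<Phi> (n - 1) x) / \<tau> n)"
    and \<rho>\<^sub>h: "\<rho>\<^sub>h = (\<lambda>x. shape_hat m shp\<^sub>p shp\<^sub>m (\<Phi> (n - 1) x) (\<Phi> n x))"
    and solution_space: "\<Phi> n \<in> fe_space \<Omega> T" "W n \<in> fe_space_Dirichlet \<Omega> T bD u\<^sub>D"
    and scheme_W: "\<forall>\<eta> \<in> fe_space_Dirichlet \<Omega> T bD 0.
          \<theta> * lumped_inner T (\<lambda>x. (W n x - W (n - 1) x) / \<tau> n) \<eta>
        + lam * lumped_inner T (\<lambda>x. \<rho>\<^sub>h x * d\<Phi> x) \<eta>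
        + L2_inner \<Omega> (\<lambda>x. b\<^sub>h x *\<^sub>R grad (W n) x) (grad \<eta>) = 0"
    and scheme_\<Phi>: "\<forall>\<eta> \<in> fe_space \<Omega> T.
          \<epsilon> * (\<rho> / \<alpha>) * lumped_inner T (\<lambda>x. \<mu> (grad (\<Phi> (n - 1)) x) * d\<Phi> x) \<eta>
        + \<epsilon> * L2_inner \<Omega>
            (\<lambda>x. anisotropy_matrix r L G (grad (\<Phi> (n - 1)) x) (grad (\<Phi> n) x) *v grad (\<Phi> n) x)
            (grad \<eta>)
        + 1 / \<epsilon> * lumped_inner T (\<lambda>x. \<phi>\<^sub>p (\<Phi> n x)) \<eta>
        = lumped_inner T
            (\<lambda>x. c_pot \<Psi> * (a / \<alpha>) * \<rho>\<^sub>h x * W n x - 1 / \<epsilon> * \<phi>\<^sub>m (\<Phi> (n - 1) x)) \<eta>"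
  shows
    "energy_E \<Omega> T \<epsilon> \<theta> lam \<alpha> a u\<^sub>D \<gamma> \<Psi> (W n) (\<Phi> n)
       - u\<^sub>D * lam * lumped_inner T \<rho>\<^sub>h (\<lambda>x. \<Phi> n x - \<Phi> (n - 1) x)
       + \<tau> n * L2_inner \<Omega> (\<lambda>x. b\<^sub>h x *\<^sub>R grad (W n) x) (grad (W n))
       + \<tau> n * (lam * \<rho> / a) * (\<epsilon> / c_pot \<Psi>) *
           (lumped_norm T (\<lambda>x. sqrt (\<mu> (grad (\<Phi> (n - 1)) x)) * d\<Phi> x))\<^sup>2
       \<le> energy_E \<Omega> T \<epsilon> \<theta> lam \<alpha> a u\<^sub>D \<gamma> \<Psi> (W (n - 1)) (\<Phi> (n - 1))
     \<and>
     ( ((\<forall>x\<in>\<Omega>. trunc_at m shp\<^sub>p (\<Phi> n x) = shp\<^sub>p (\<Phi> n x)) \<and>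
        ( (\<forall>s \<le> 2 / sqrt 3. u\<^sub>D * deriv shp\<^sub>p s \<le> 0 \<and> - u\<^sub>D * deriv shp\<^sub>m s \<le> 0) \<and>
          (\<forall>x\<in>\<Omega>. \<Phi> (n - 1) x \<le> 2 / sqrt 3 \<and> \<Phi> n x \<le> 2 / sqrt 3)
        \<or> (\<forall>s \<ge> - 2 / sqrt 3. u\<^sub>D * deriv shp\<^sub>p s \<le> 0 \<and> - u\<^sub>D * deriv shp\<^sub>m s \<le> 0) \<and>
          (\<forall>x\<in>\<Omega>. \<Phi> (n - 1) x \<ge> - 2 / sqrt 3 \<and> \<Phi> n x \<ge> - 2 / sqrt 3)))
       \<longrightarrow>
       energy_F \<Omega> T \<epsilon> \<theta> lam \<alpha> a u\<^sub>D \<gamma> \<Psi> shp (W n) (\<Phi> n)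
         + \<tau> n * L2_inner \<Omega> (\<lambda>x. b\<^sub>h x *\<^sub>R grad (W n) x) (grad (W n))
         + \<tau> n * (lam * \<rho> / a) * (\<epsilon> / c_pot \<Psi>) *
             (lumped_norm T (\<lambda>x. sqrt (\<mu> (grad (\<Phi> (n - 1)) x)) * d\<Phi> x))\<^sup>2
         \<le> energy_F \<Omega> T \<epsilon> \<theta> lam \<alpha> a u\<^sub>D \<gamma> \<Psi> shp (W (n - 1)) (\<Phi> (n - 1)))"
proof -
  note lumped_simps = lumped_sum_add[symmetric] lumped_sum_diff[symmetric] lumped_sum_cmult[symmetric]
  have bdd: "bounded \<Omega>"
    using domain by (simp add: polyhedral_domain_def)
  have \<tau>0: "\<tau> n > 0" and c0: "c_pot \<Psi> > 0"
    using step c_pot_pos[OF \<Psi>(1)] by auto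
  have \<Phi>n: "\<Phi> n \<in> fe_space \<Omega> T" and Wn: "W n \<in> fe_space \<Omega> T"
    using solution_space by (auto simp: fe_space_Dirichlet_def)
  have \<Phi>o: "\<Phi> (n - 1) \<in> fe_space \<Omega> T"
  proof (cases "n = 1")
    case True
    then show ?thesis using previous_\<Phi> by (simp add: fe_space_bounded_def)
  next
    case False
    then show ?thesis using previous_\<Phi> step by simp
  qed
  obtain g1 where g1: "GDERIV (\<Phi> n) x :> g1 \<sigma>" if "\<sigma> \<in> T" "x \<in> \<sigma>" for \<sigma> x
    using fe_space_grad[OF mesh \<Phi>n] by blast
  obtain g0 where g0: "GDERIV (\<Phi> (n - 1)) x :> g0 \<sigma>" if "\<sigma> \<in> T" "x \<in> \<sigma>" for \<sigma> x
    using fe_space_grad[OF mesh \<Phi>o] by blast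
  let ?\<delta> = "\<lambda>p. \<Phi> n p - \<Phi> (n - 1) p"

  have lim\<Phi>: "(\<Phi> n \<longlongrightarrow> \<Phi> n p) (at p within \<sigma>)" "(\<Phi> (n - 1) \<longlongrightarrow> \<Phi> (n - 1) p) (at p within \<sigma>)"
    and limW: "(W n \<longlongrightarrow> W n p) (at p within \<sigma>)"
    if "\<sigma> \<in> T" "p \<in> vertices \<sigma>" for \<sigma> p
    using fe_space_tendsto_vertex[OF mesh \<Phi>n that] fe_space_tendsto_vertex[OF mesh \<Phi>o that]
      fe_space_tendsto_vertex[OF mesh Wn that] .
  have lim\<delta>: "(?\<delta> \<longlongrightarrow> ?\<delta> p) (at p within \<sigma>)" if "\<sigma> \<in> T" "p \<in> vertices \<sigma>" for \<sigma> p
    by (intro tendsto_diff lim\<Phi> that)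
  have limd: "(d\<Phi> \<longlongrightarrow> ?\<delta> p / \<tau> n) (at p within \<sigma>)" if "\<sigma> \<in> T" "p \<in> vertices \<sigma>" for \<sigma> p
    unfolding d\<Phi> by (intro tendsto_divide lim\<delta> that tendsto_const) (use \<tau>0 in simp)
  have lim\<mu>: "((\<lambda>x. \<mu> (grad (\<Phi> (n - 1)) x)) \<longlongrightarrow> \<mu> (g0 \<sigma>)) (at p within \<sigma>)" if "\<sigma> \<in> T" for \<sigma> p
  proof (rule tendsto_eventually)
    show "\<forall>\<^sub>F x in at p within \<sigma>. \<mu> (grad (\<Phi> (n - 1)) x) = \<mu> (g0 \<sigma>)"
      using grad_eqI[OF g0[OF that]] by (auto simp: eventually_at_filter intro!: always_eventually)
  qed
  have C1: "shp\<^sub>p C1_differentiable_on UNIV" "shp\<^sub>m C1_differentiable_on UNIV"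
    using shp(2) by (auto simp: shape_splitting_def)
  have trunc_cont: "isCont (trunc_at m shp\<^sub>p) s" for s
    by (rule isCont_trunc_at) (use m C1 in auto)
  have lim\<rho>: "(\<rho>\<^sub>h \<longlongrightarrow> \<rho>\<^sub>h p) (at p within \<sigma>)" if "\<sigma> \<in> T" "p \<in> vertices \<sigma>" for \<sigma> p
    unfolding \<rho>\<^sub>h shape_hat_def
    by (intro tendsto_add isCont_tendsto_compose[OF C1_UNIV_isCont[OF C1(2)]]
        isCont_tendsto_compose[OF trunc_cont] lim\<Phi> that)
  have \<phi>_cont: "isCont \<phi>\<^sub>p s" "isCont \<phi>\<^sub>m s" and \<Psi>_cont: "isCont \<Psi> s"
    and P_cont: "isCont (shape_primitive shp) s" for s
    using \<Psi>(2) DERIV_isCont[OF double_well_has_deriv[OF \<Psi>(1)]]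
      DERIV_isCont[OF shape_primitive_has_deriv[OF shp(1)]]
    by (auto simp: potential_splitting_def intro: differentiable_imp_continuous_within)
  have lim\<phi>: "((\<lambda>x. \<phi>\<^sub>p (\<Phi> n x)) \<longlongrightarrow> \<phi>\<^sub>p (\<Phi> n p)) (at p within \<sigma>)"
    "((\<lambda>x. \<phi>\<^sub>m (\<Phi> (n - 1) x)) \<longlongrightarrow> \<phi>\<^sub>m (\<Phi> (n - 1) p)) (at p within \<sigma>)"
    if "\<sigma> \<in> T" "p \<in> vertices \<sigma>" for \<sigma> p
    by (intro isCont_tendsto_compose[OF \<phi>_cont(1)] isCont_tendsto_compose[OF \<phi>_cont(2)] lim\<Phi> that)+

  define I1 where "I1 = lumped_sum T (\<lambda>\<sigma> p. (W n p - W (n - 1) p) * (W n p - u\<^sub>D))"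
  define IR where "IR = lumped_sum T (\<lambda>\<sigma> p. \<rho>\<^sub>h p * ?\<delta> p)"
  define IW where "IW = lumped_sum T (\<lambda>\<sigma> p. \<rho>\<^sub>h p * W n p * ?\<delta> p)"
  define M where "M = lumped_sum T (\<lambda>\<sigma> p. \<mu> (g0 \<sigma>) * (?\<delta> p)\<^sup>2)"
  define Fp where "Fp = lumped_sum T (\<lambda>\<sigma> p. \<phi>\<^sub>p (\<Phi> n p) * ?\<delta> p)"
  define Fm where "Fm = lumped_sum T (\<lambda>\<sigma> p. \<phi>\<^sub>m (\<Phi> (n - 1) p) * ?\<delta> p)"
  define P1 where "P1 = lumped_inner T (\<lambda>x. \<Psi> (\<Phi> n x)) (\<lambda>x. 1)"
  define P0 where "P0 = lumped_inner T (\<lambda>x. \<Psi> (\<Phi> (n - 1) x)) (\<lambda>x. 1)"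
  define \<Gamma>1 where "\<Gamma>1 = (L2_norm \<Omega> (\<lambda>x. \<gamma> (grad (\<Phi> n) x)))\<^sup>2"
  define \<Gamma>0 where "\<Gamma>0 = (L2_norm \<Omega> (\<lambda>x. \<gamma> (grad (\<Phi> (n - 1)) x)))\<^sup>2"
  define A where "A = L2_inner \<Omega>
      (\<lambda>x. anisotropy_matrix r L G (grad (\<Phi> (n - 1)) x) (grad (\<Phi> n) x) *v grad (\<Phi> n) x) (grad ?\<delta>)"
  define D where "D = L2_inner \<Omega> (\<lambda>x. b\<^sub>h x *\<^sub>R grad (W n) x) (grad (W n))"
  define M' where "M' = (lumped_norm T (\<lambda>x. sqrt (\<mu> (grad (\<Phi> (n - 1)) x)) * d\<Phi> x))\<^sup>2"
  define k where "k = lam * \<alpha> / (a * c_pot \<Psi>)"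
  have k0: "0 < k" using parameters c0 by (simp add: k_def)

  have \<theta>N: "\<theta> / 2 * (lumped_norm T (\<lambda>x. W n x - u\<^sub>D))\<^sup>2
      - \<theta> / 2 * (lumped_norm T (\<lambda>x. W (n - 1) x - u\<^sub>D))\<^sup>2 \<le> \<theta> * I1"
    and \<theta>I: "\<theta> * lumped_inner T (\<lambda>x. (W n x - W (n - 1) x) / \<tau> n) (\<lambda>x. W n x - u\<^sub>D) = \<theta> * I1 / \<tau> n"
  proof -
    have "\<theta> / 2 * (lumped_norm T (\<lambda>x. W n x - u\<^sub>D))\<^sup>2
        - \<theta> / 2 * (lumped_norm T (\<lambda>x. W (n - 1) x - u\<^sub>D))\<^sup>2 \<le> \<theta> * I1 \<and>
      \<theta> * lumped_inner T (\<lambda>x. (W n x - W (n - 1) x) / \<tau> n) (\<lambda>x. W n x - u\<^sub>D) = \<theta> * I1 / \<tau> n"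
    \<comment> \<open>Nothing is known about \<open>W (n - 1)\<close> if \<open>\<theta> = 0\<close>.\<close>
    proof (cases "\<theta> = 0")
      case False
      then have "W (n - 1) \<in> fe_space \<Omega> T"
        using previous_W by (simp add: fe_space_Dirichlet_def)
      then have limWo: "(W (n - 1) \<longlongrightarrow> W (n - 1) p) (at p within \<sigma>)" if "\<sigma> \<in> T" "p \<in> vertices \<sigma>" for \<sigma> p
        using that by (intro fe_space_tendsto_vertex[OF mesh])
      have N1: "(lumped_norm T (\<lambda>x. W n x - u\<^sub>D))\<^sup>2 = lumped_sum T (\<lambda>\<sigma> p. (W n p - u\<^sub>D)\<^sup>2)"
        by (rule lumped_norm_power2[OF mesh]) (intro tendsto_intros limW)
      have N0: "(lumped_norm T (\<lambda>x. W (n - 1) x - u\<^sub>D))\<^sup>2 = lumped_sum T (\<lambda>\<sigma> p. (W (n - 1) p - u\<^sub>D)\<^sup>2)"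
        by (rule lumped_norm_power2[OF mesh]) (intro tendsto_intros limWo)
      have "lumped_sum T (\<lambda>\<sigma> p. (W n p - u\<^sub>D)\<^sup>2) - lumped_sum T (\<lambda>\<sigma> p. (W (n - 1) p - u\<^sub>D)\<^sup>2) \<le> 2 * I1"
        unfolding I1_def lumped_simps
      proof (rule lumped_sum_mono)
        fix p
        show "(W n p - u\<^sub>D)\<^sup>2 - (W (n - 1) p - u\<^sub>D)\<^sup>2 \<le> 2 * ((W n p - W (n - 1) p) * (W n p - u\<^sub>D))"
          using zero_le_power2[of "W n p - W (n - 1) p"] by (simp add: power2_eq_square algebra_simps)
      qed
      then have "\<theta> / 2 * ((lumped_norm T (\<lambda>x. W n x - u\<^sub>D))\<^sup>2
          - (lumped_norm T (\<lambda>x. W (n - 1) x - u\<^sub>D))\<^sup>2) \<le> \<theta> / 2 * (2 * I1)"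
        unfolding N1 N0 using parameters(2) by (intro mult_left_mono) auto
      moreover have "lumped_inner T (\<lambda>x. (W n x - W (n - 1) x) / \<tau> n) (\<lambda>x. W n x - u\<^sub>D) =
          lumped_sum T (\<lambda>\<sigma> p. (W n p - W (n - 1) p) / \<tau> n * (W n p - u\<^sub>D))"
        by (rule lumped_inner_eq[OF mesh]) (intro tendsto_intros limW limWo; use \<tau>0 in simp)
      moreover have "\<dots> = I1 / \<tau> n"
        using lumped_sum_cmult[of T "1 / \<tau> n"] by (simp add: I1_def)
      ultimately show ?thesis by (simp add: right_diff_distrib)
    qed simp
    then show "\<theta> / 2 * (lumped_norm T (\<lambda>x. W n x - u\<^sub>D))\<^sup>2
        - \<theta> / 2 * (lumped_norm T (\<lambda>x. W (n - 1) x - u\<^sub>D))\<^sup>2 \<le> \<theta> * I1"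
      "\<theta> * lumped_inner T (\<lambda>x. (W n x - W (n - 1) x) / \<tau> n) (\<lambda>x. W n x - u\<^sub>D) = \<theta> * I1 / \<tau> n"
      by blast+
  qed

  have eqW: "\<theta> * I1 + lam * (IW - u\<^sub>D * IR) + \<tau> n * D = 0"
  proof -
    have "(\<lambda>x. W n x - u\<^sub>D) \<in> fe_space_Dirichlet \<Omega> T bD 0"
      using solution_space(2) fe_space_diff[OF Wn fe_space_const] by (simp add: fe_space_Dirichlet_def)
    from scheme_W[rule_format, OF this]
    have "\<theta> * I1 / \<tau> n + lam * lumped_inner T (\<lambda>x. \<rho>\<^sub>h x * d\<Phi> x) (\<lambda>x. W n x - u\<^sub>D) + D = 0"
      by (simp only: \<theta>I grad_diff_const D_def)
    moreover have "lumped_inner T (\<lambda>x. \<rho>\<^sub>h x * d\<Phi> x) (\<lambda>x. W n x - u\<^sub>D) =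
        lumped_sum T (\<lambda>\<sigma> p. \<rho>\<^sub>h p * (?\<delta> p / \<tau> n) * (W n p - u\<^sub>D))"
      by (rule lumped_inner_eq[OF mesh]) (intro tendsto_intros lim\<rho> limd limW)
    moreover have "\<dots> = 1 / \<tau> n * (IW - u\<^sub>D * IR)"
      unfolding IW_def IR_def lumped_simps by (simp add: algebra_simps diff_divide_distrib)
    ultimately have "\<theta> * I1 / \<tau> n + lam * (1 / \<tau> n * (IW - u\<^sub>D * IR)) + D = 0"
      by simp
    then have "\<tau> n * (\<theta> * I1 / \<tau> n + lam * (1 / \<tau> n * (IW - u\<^sub>D * IR)) + D) = 0"
      by simp
    then show ?thesis using \<tau>0 by (simp add: distrib_left)
  qed

  have eq\<Phi>: "\<epsilon> * (\<rho> / \<alpha>) * (M / \<tau> n) + \<epsilon> * A + 1 / \<epsilon> * (Fp + Fm) = c_pot \<Psi> * (a / \<alpha>) * IW"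
  proof -
    have "lumped_inner T (\<lambda>x. \<mu> (grad (\<Phi> (n - 1)) x) * d\<Phi> x) ?\<delta> =
        lumped_sum T (\<lambda>\<sigma> p. \<mu> (g0 \<sigma>) * (?\<delta> p / \<tau> n) * ?\<delta> p)"
      by (rule lumped_inner_eq[OF mesh]) (intro tendsto_mult lim\<mu> limd lim\<delta>)
    also have "\<dots> = M / \<tau> n"
      using lumped_sum_cmult[of T "1 / \<tau> n"] by (simp add: M_def power2_eq_square mult.assoc)
    finally have 1: "lumped_inner T (\<lambda>x. \<mu> (grad (\<Phi> (n - 1)) x) * d\<Phi> x) ?\<delta> = M / \<tau> n" .
    have 2: "lumped_inner T (\<lambda>x. \<phi>\<^sub>p (\<Phi> n x)) ?\<delta> = Fp"
      unfolding Fp_def by (rule lumped_inner_eq[OF mesh]) (intro tendsto_mult lim\<phi> lim\<delta>)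
    have "lumped_inner T (\<lambda>x. c_pot \<Psi> * (a / \<alpha>) * \<rho>\<^sub>h x * W n x - 1 / \<epsilon> * \<phi>\<^sub>m (\<Phi> (n - 1) x)) ?\<delta> =
        lumped_sum T (\<lambda>\<sigma> p. (c_pot \<Psi> * (a / \<alpha>) * \<rho>\<^sub>h p * W n p - 1 / \<epsilon> * \<phi>\<^sub>m (\<Phi> (n - 1) p)) * ?\<delta> p)"
      by (rule lumped_inner_eq[OF mesh])
        (intro tendsto_mult tendsto_diff tendsto_const lim\<rho> limW lim\<phi> lim\<delta>)
    also have "\<dots> = c_pot \<Psi> * (a / \<alpha>) * IW - 1 / \<epsilon> * Fm"
      unfolding IW_def Fm_def lumped_simps by (simp only: left_diff_distrib mult.assoc)
    finally have 3: "lumped_inner T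
        (\<lambda>x. c_pot \<Psi> * (a / \<alpha>) * \<rho>\<^sub>h x * W n x - 1 / \<epsilon> * \<phi>\<^sub>m (\<Phi> (n - 1) x)) ?\<delta> =
      c_pot \<Psi> * (a / \<alpha>) * IW - 1 / \<epsilon> * Fm" .
    from scheme_\<Phi>[rule_format, OF fe_space_diff[OF \<Phi>n \<Phi>o]]
    show ?thesis unfolding 1 2 3 A_def[symmetric] by (simp add: distrib_left)
  qed

  have \<Gamma>: "\<Gamma>1 / 2 - \<Gamma>0 / 2 \<le> A"
  proof -
    have sq: "(L2_norm \<Omega> (\<lambda>x. \<gamma> (grad \<eta> x)))\<^sup>2 = (\<Sum>\<sigma>\<in>T. measure lebesgue \<sigma> * (\<gamma> (g \<sigma>))\<^sup>2)"
      if "\<And>\<sigma> x. \<sigma> \<in> T \<Longrightarrow> x \<in> \<sigma> \<Longrightarrow> GDERIV \<eta> x :> g \<sigma>" for \<eta> g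
    proof -
      have "L2_inner \<Omega> (\<lambda>x. \<gamma> (grad \<eta> x)) (\<lambda>x. \<gamma> (grad \<eta> x)) = (\<Sum>\<sigma>\<in>T. measure lebesgue \<sigma> * (\<gamma> (g \<sigma>))\<^sup>2)"
        unfolding L2_inner_def
        by (rule set_integral_simplexwise_const[OF mesh bdd])
          (simp add: grad_eqI[OF that] power2_eq_square)
      then show ?thesis by (simp add: L2_norm_def sum_nonneg)
    qed
    have "A = (\<Sum>\<sigma>\<in>T. measure lebesgue \<sigma> *
        ((anisotropy_matrix r L G (g0 \<sigma>) (g1 \<sigma>) *v g1 \<sigma>) \<bullet> (g1 \<sigma> - g0 \<sigma>)))"
      unfolding A_def L2_inner_def
      by (rule set_integral_simplexwise_const[OF mesh bdd])
        (simp only: grad_eqI[OF g0] grad_eqI[OF g1] grad_eqI[OF GDERIV_diff[OF g1 g0]])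
    moreover have "\<Gamma>1 / 2 - \<Gamma>0 / 2 =
        (\<Sum>\<sigma>\<in>T. measure lebesgue \<sigma> * ((\<gamma> (g1 \<sigma>))\<^sup>2 / 2 - (\<gamma> (g0 \<sigma>))\<^sup>2 / 2))"
      using sq[of "\<Phi> n" g1, OF g1] sq[of "\<Phi> (n - 1)" g0, OF g0]
      by (simp add: \<Gamma>1_def \<Gamma>0_def right_diff_distrib sum_subtractf sum_divide_distrib)
    ultimately show ?thesis
      using anisotropy_matrix_energy[OF r L G] by (auto simp: \<gamma> intro!: sum_mono mult_left_mono)
  qed

  have lump1: "lumped_inner T (\<lambda>x. f (\<eta> x)) (\<lambda>x. 1) = lumped_sum T (\<lambda>\<sigma> p. f (\<eta> p))"
    if "\<eta> \<in> fe_space \<Omega> T" "\<And>s. isCont f s" for f :: "real \<Rightarrow> real" and \<eta> :: "real^'d \<Rightarrow> real"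
    by (rule lumped_inner_eq[OF mesh], simp only: mult_1_right)
      (intro isCont_tendsto_compose[OF that(2)] fe_space_tendsto_vertex[OF mesh that(1)])

  have pot: "P1 - P0 \<le> Fp + Fm"
    unfolding P1_def P0_def Fp_def Fm_def lump1[OF \<Phi>n \<Psi>_cont] lump1[OF \<Phi>o \<Psi>_cont] lumped_simps
    by (rule lumped_sum_mono) (use potential_splitting_le[OF \<Psi>(1,2)] in \<open>simp add: distrib_right\<close>)

  have M': "M' = M / (\<tau> n)\<^sup>2"
  proof -
    have \<mu>0: "0 \<le> \<mu> p" for p
      unfolding \<mu> using kinetic_mobility_nonneg[OF _ \<beta> \<mu>\<^sub>0] anisotropy_nonneg \<gamma> by metis
    have "M' = lumped_sum T (\<lambda>\<sigma> p. (sqrt (\<mu> (g0 \<sigma>)) * (?\<delta> p / \<tau> n))\<^sup>2)"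
      unfolding M'_def
      by (rule lumped_norm_power2[OF mesh]) (intro tendsto_mult tendsto_real_sqrt lim\<mu> limd)
    also have "\<dots> = lumped_sum T (\<lambda>\<sigma> p. 1 / (\<tau> n)\<^sup>2 * (\<mu> (g0 \<sigma>) * (?\<delta> p)\<^sup>2))"
      by (simp add: power_mult_distrib power_divide \<mu>0)
    finally show ?thesis
      by (simp only: lumped_sum_cmult M_def)  simp
  qed

  have estimate: "energy_E \<Omega> T \<epsilon> \<theta> lam \<alpha> a u\<^sub>D \<gamma> \<Psi> (W n) (\<Phi> n) - u\<^sub>D * lam * IR
      + \<tau> n * D + \<tau> n * (lam * \<rho> / a) * (\<epsilon> / c_pot \<Psi>) * M'
      \<le> energy_E \<Omega> T \<epsilon> \<theta> lam \<alpha> a u\<^sub>D \<gamma> \<Psi> (W (n - 1)) (\<Phi> (n - 1))"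
  proof -
    \<comment> \<open>The second equation times \<open>k\<close> and the first one have the term \<open>lam * IW\<close> in common.\<close>
    have "k * (\<epsilon> * (\<rho> / \<alpha>) * (M / \<tau> n) + \<epsilon> * A + 1 / \<epsilon> * (Fp + Fm)) = lam * IW"
      unfolding eq\<Phi> using parameters c0 by (simp add: k_def)
    moreover have "k * (\<epsilon> * (\<rho> / \<alpha>) * (M / \<tau> n)) = \<tau> n * (lam * \<rho> / a) * (\<epsilon> / c_pot \<Psi>) * M'"
      using parameters c0 \<tau>0 by (simp add: k_def M' power2_eq_square)
    moreover have "k * (\<epsilon> * (\<Gamma>1 / 2 - \<Gamma>0 / 2)) \<le> k * (\<epsilon> * A)"
      using \<Gamma> k0 parameters by (intro mult_left_mono) auto
    moreover have "k * (1 / \<epsilon> * (P1 - P0)) \<le> k * (1 / \<epsilon> * (Fp + Fm))"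
      using pot k0 parameters by (intro mult_left_mono) auto
    moreover have "k * (1 / \<epsilon> * (P1 - P0)) = k * (1 / \<epsilon> * P1) - k * (1 / \<epsilon> * P0)"
      "k * (\<epsilon> * (\<Gamma>1 / 2 - \<Gamma>0 / 2)) = k * (1 / 2 * \<epsilon> * \<Gamma>1) - k * (1 / 2 * \<epsilon> * \<Gamma>0)"
      "lam * (IW - u\<^sub>D * IR) = lam * IW - u\<^sub>D * lam * IR"
      by (simp_all add: algebra_simps diff_divide_distrib)
    moreover have "lam * \<alpha> / a * (1 / c_pot \<Psi>) = k"
      by (simp add: k_def)
    ultimately show ?thesis
      using eqW \<theta>N
      unfolding energy_E_def P1_def[symmetric] P0_def[symmetric] \<Gamma>1_def[symmetric] \<Gamma>0_def[symmetric]
      by (simp only: distrib_left)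
  qed

  have IR_eq: "lumped_inner T \<rho>\<^sub>h ?\<delta> = IR"
    unfolding IR_def by (rule lumped_inner_eq[OF mesh]) (intro tendsto_mult lim\<rho> lim\<delta>)

  have shape: "u\<^sub>D * IR \<le> u\<^sub>D * (lumped_inner T (\<lambda>x. shape_primitive shp (\<Phi> n x)) (\<lambda>x. 1)
      - lumped_inner T (\<lambda>x. shape_primitive shp (\<Phi> (n - 1) x)) (\<lambda>x. 1))"
    if trunc: "\<And>x. x \<in> \<Omega> \<Longrightarrow> trunc_at m shp\<^sub>p (\<Phi> n x) = shp\<^sub>p (\<Phi> n x)"
      and S: "closed S" "is_interval S"
      and mon: "\<And>s. s \<in> S \<Longrightarrow> u\<^sub>D * deriv shp\<^sub>p s \<le> 0 \<and> - u\<^sub>D * deriv shp\<^sub>m s \<le> 0"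
      and mem: "\<And>x. x \<in> \<Omega> \<Longrightarrow> \<Phi> (n - 1) x \<in> S \<and> \<Phi> n x \<in> S" for S
    unfolding IR_def lump1[OF \<Phi>n P_cont] lump1[OF \<Phi>o P_cont] lumped_simps
  proof (rule lumped_sum_mono)
    fix \<sigma> p assume p: "\<sigma> \<in> T" "p \<in> vertices \<sigma>"
    \<comment> \<open>The hypotheses hold in the open set \<open>\<Omega>\<close> and pass to the vertices on the boundary by continuity.\<close>
    have "closed {s. trunc_at m shp\<^sub>p s = shp\<^sub>p s}"
      using trunc_cont C1_UNIV_isCont[OF C1(1)]
      by (intro closed_Collect_eq) (auto intro: continuous_at_imp_continuous_on)
    then have "\<Phi> n p \<in> {s. trunc_at m shp\<^sub>p s = shp\<^sub>p s}"
      using trunc by (intro vertex_value_in_closed[OF mesh \<Phi>n _ _ p]) auto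
    then have "\<rho>\<^sub>h p = shp\<^sub>m (\<Phi> (n - 1) p) + shp\<^sub>p (\<Phi> n p)"
      by (simp add: \<rho>\<^sub>h shape_hat_def)
    moreover have "\<Phi> n p \<in> S" "\<Phi> (n - 1) p \<in> S"
      using vertex_value_in_closed[OF mesh \<Phi>n S(1) _ p] vertex_value_in_closed[OF mesh \<Phi>o S(1) _ p] mem
      by blast+
    ultimately show "u\<^sub>D * (\<rho>\<^sub>h p * ?\<delta> p) \<le>
        u\<^sub>D * (shape_primitive shp (\<Phi> n p) - shape_primitive shp (\<Phi> (n - 1) p))"
      using shape_splitting_le[OF shp S(2) _ _ mon] by simp
  qed

  show ?thesis
    unfolding IR_eq D_def[symmetric] M'_def[symmetric]
  proof (intro conjI impI estimate)
    assume asm: "(\<forall>x\<in>\<Omega>. trunc_at m shp\<^sub>p (\<Phi> n x) = shp\<^sub>p (\<Phi> n x)) \<and>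
        ( (\<forall>s \<le> 2 / sqrt 3. u\<^sub>D * deriv shp\<^sub>p s \<le> 0 \<and> - u\<^sub>D * deriv shp\<^sub>m s \<le> 0) \<and>
          (\<forall>x\<in>\<Omega>. \<Phi> (n - 1) x \<le> 2 / sqrt 3 \<and> \<Phi> n x \<le> 2 / sqrt 3)
        \<or> (\<forall>s \<ge> - 2 / sqrt 3. u\<^sub>D * deriv shp\<^sub>p s \<le> 0 \<and> - u\<^sub>D * deriv shp\<^sub>m s \<le> 0) \<and>
          (\<forall>x\<in>\<Omega>. \<Phi> (n - 1) x \<ge> - 2 / sqrt 3 \<and> \<Phi> n x \<ge> - 2 / sqrt 3))"
    have "u\<^sub>D * IR \<le> u\<^sub>D * (lumped_inner T (\<lambda>x. shape_primitive shp (\<Phi> n x)) (\<lambda>x. 1)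
        - lumped_inner T (\<lambda>x. shape_primitive shp (\<Phi> (n - 1) x)) (\<lambda>x. 1))"
      using asm
    proof (elim conjE disjE)
      assume t: "\<forall>x\<in>\<Omega>. trunc_at m shp\<^sub>p (\<Phi> n x) = shp\<^sub>p (\<Phi> n x)"
        and m: "\<forall>s \<le> 2 / sqrt 3. u\<^sub>D * deriv shp\<^sub>p s \<le> 0 \<and> - u\<^sub>D * deriv shp\<^sub>m s \<le> 0"
        and b: "\<forall>x\<in>\<Omega>. \<Phi> (n - 1) x \<le> 2 / sqrt 3 \<and> \<Phi> n x \<le> 2 / sqrt 3"
      show ?thesis
        by (rule shape[where S = "{..2 / sqrt 3}"])
          (use t m b in \<open>auto simp only: atMost_iff closed_atMost is_interval_ic\<close>)
    next
      assume t: "\<forall>x\<in>\<Omega>. trunc_at m shp\<^sub>p (\<Phi> n x) = shp\<^sub>p (\<Phi> n x)"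
        and m: "\<forall>s \<ge> - 2 / sqrt 3. u\<^sub>D * deriv shp\<^sub>p s \<le> 0 \<and> - u\<^sub>D * deriv shp\<^sub>m s \<le> 0"
        and b: "\<forall>x\<in>\<Omega>. \<Phi> (n - 1) x \<ge> - 2 / sqrt 3 \<and> \<Phi> n x \<ge> - 2 / sqrt 3"
      show ?thesis
        by (rule shape[where S = "{- 2 / sqrt 3..}"])
          (use t m b in \<open>auto simp only: atLeast_iff closed_atLeast is_interval_ci\<close>)
    qed
    from mult_left_mono[OF this, of lam] estimate parameters
    show "energy_F \<Omega> T \<epsilon> \<theta> lam \<alpha> a u\<^sub>D \<gamma> \<Psi> shp (W n) (\<Phi> n)
         + \<tau> n * D + \<tau> n * (lam * \<rho> / a) * (\<epsilon> / c_pot \<Psi>) * M'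
         \<le> energy_F \<Omega> T \<epsilon> \<theta> lam \<alpha> a u\<^sub>D \<gamma> \<Psi> shp (W (n - 1)) (\<Phi> (n - 1))"
      unfolding energy_F_def by (simp add: right_diff_distrib mult_ac)
  qed
qed

end
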